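(* For real numbers $Q$ and $D$, let $N(Q,D)$ denote the number of polynomials $p(x)=ax^2+bx+c\in\mathbb{Z}[x]$ of degree exactly $2$ (i.e. $a\neq 0$) whose height $H(p)=\max(|a|,|b|,|c|)$ satisfies $H(p)\le Q$ and whose discriminant $D(p)=b^2-4ac$ satisfies $|D(p)|\le D$. Then for all $D$ and $Q$ with $1\le D\le Q^2/2$, \[ N(Q,D)=\kappa QD+O\!\left(D^{3/2}\ln Q+(Q\ln Q)^{3/2}\right), \] where $\kappa=4(\ln 2+1)=6.772588\ldots$ and the implied constant in $O(\cdot)$ is absolute.
   Context: The height of an integer polynomial is the maximum absolute value of its coefficients. For a quadratic polynomial $ax^2+bx+c$ the discriminant is $b^2-4ac$. *)

theory Defs
  imports
    "HOL-Analysis.Analysis"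
    "HOL-Computational_Algebra.Polynomial"
    "HOL-Library.Quadratic_Discriminant"
begin

definition poly_height :: "int poly \<Rightarrow> int" where
  "poly_height p = Max ((\<lambda>i. \<bar>coeff p i\<bar>) ` {..degree p})"

text \<open>Meaningful for quadratic polynomials only; \<^const>\<open>discrim\<close> takes the coefficients in
  order of decreasing degree.\<close>

definition quadratic_discrim :: "int poly \<Rightarrow> real" where
  "quadratic_discrim p =
     discrim (of_int (coeff p 2)) (of_int (coeff p 1)) (of_int (coeff p 0))"

definition quadratics :: "real \<Rightarrow> real \<Rightarrow> int poly set" where
  "quadratics Q D =
     {p. degree p = 2 \<and> of_int (poly_height p) \<le> Q \<and> \<bar>quadratic_discrim p\<bar> \<le> D}"

text \<open>The coefficients are bounded by \<open>Q\<close>, so the set is finite and \<^const>\<open>card\<close> is the true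
  number of its elements.\<close>

lemma finite_quadratics: "finite (quadratics Q D)"
proof (rule finite_subset)
  let ?I = "{- \<lfloor>Q\<rfloor>..\<lfloor>Q\<rfloor>}"
  show "quadratics Q D \<subseteq> (\<lambda>(a, b, c). [:c, b, a:]) ` (?I \<times> ?I \<times> ?I)"
  proof
    fix p assume p: "p \<in> quadratics Q D"
    then have deg: "degree p = 2" and ht: "poly_height p \<le> \<lfloor>Q\<rfloor>"
      by (auto simp: quadratics_def le_floor_iff)
    have bd: "coeff p i \<in> ?I" if "i \<le> 2" for i
    proof -
      have "\<bar>coeff p i\<bar> \<le> poly_height p"
        unfolding poly_height_def using that deg by (intro Max_ge) auto
      then show ?thesis using ht by auto
    qed
    have "p = [:coeff p 0, coeff p 1, coeff p 2:]"
    proof (rule poly_eqI)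
      fix n
      show "coeff p n = coeff [:coeff p 0, coeff p 1, coeff p 2:] n"
        using deg by (auto simp: coeff_pCons coeff_eq_0 numeral_2_eq_2 split: nat.split)
    qed
    then show "p \<in> (\<lambda>(a, b, c). [:c, b, a:]) ` (?I \<times> ?I \<times> ?I)"
      by (intro image_eqI[of _ _ "(coeff p 2, coeff p 1, coeff p 0)"]) (auto simp del: atLeastAtMost_iff intro: bd)
  qed
qed auto

definition count_quadratics :: "real \<Rightarrow> real \<Rightarrow> nat" where
  "count_quadratics Q D = card (quadratics Q D)"

definition kappa :: real where
  "kappa = 4 * (ln 2 + 1)"

end

theory Submission
  imports Defs
begin

text \<open>Negating the polynomial reduces the count to \<open>a \<ge> 1\<close>. For fixed \<open>a\<close> the conditions
  \<open>\<bar>b\<bar> \<le> Q\<close>, \<open>\<bar>c\<bar> \<le> Q\<close> may be replaced by \<open>\<bar>b\<bar> \<le> min Q (2 * sqrt (a * Q))\<close> with \<open>c\<close> free, which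
  costs \<open>O(sqrt D * (D / a + 1))\<close> points. What remains is to count the \<open>b\<close> in an interval
  and the \<open>d\<close> with \<open>\<bar>d\<bar> \<le> D\<close> such that \<open>b\<^sup>2\<close> and \<open>d\<close> are congruent modulo \<open>4 * a\<close>. A discrete
  Fourier expansion modulo \<open>4 * a\<close> and Weyl's bound for incomplete quadratic Gauss sums show
  equidistribution up to an error that sums over \<open>a\<close> to \<open>O((Q * ln Q) powr (3/2))\<close>. The main term
  is \<open>D\<close> times the sum of \<open>min Q (2 * sqrt (a * Q)) / a\<close> over \<open>a \<le> Q\<close>, which equals
  \<open>2 * (1 + ln 2) * Q + O(sqrt Q)\<close>.\<close>

subsection \<open>Exponential sums\<close>

definition unit_exp :: "real \<Rightarrow> complex" where
  "unit_exp x = cis (2 * pi * x)"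

lemma unit_exp_add: "unit_exp (x + y) = unit_exp x * unit_exp y"
  by (simp add: unit_exp_def cis_mult distrib_left)

lemma cnj_unit_exp: "cnj (unit_exp x) = unit_exp (- x)"
  by (simp add: unit_exp_def cis_cnj)

lemma norm_unit_exp [simp]: "norm (unit_exp x) = 1"
  by (simp add: unit_exp_def)

lemma unit_exp_of_int [simp]: "unit_exp (of_int n) = 1"
  unfolding unit_exp_def by (rule cis_multiple_2pi) simp

lemma norm_unit_exp_minus_one: "norm (unit_exp x - 1) = 2 * \<bar>sin (pi * x)\<bar>"
  using dist_exp_i_1[of "2 * pi * x"] by (simp add: unit_exp_def cis_conv_exp)

lemma sum_int_telescope:
  fixes f :: "int \<Rightarrow> 'a::ab_group_add"
  assumes "i \<le> j"
  shows "(\<Sum>x=i..j. f (x + 1) - f x) = f (j + 1) - f i"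
  using assms
proof (induction j rule: int_ge_induct)
  case (step j)
  have "{i..j + 1} = insert (j + 1) {i..j}" using step by auto
  then show ?case using step by simp
qed simp

text \<open>Multiplying by \<open>unit_exp t - 1\<close>, whose norm is 2|sin(pi t)|, telescopes the
  geometric sum to a difference of two unit vectors. The bound is independent of the number of
  terms.\<close>

lemma norm_sum_unit_exp_le:
  assumes "sin (pi * t) \<noteq> 0"
  shows "norm (\<Sum>x=i..j. unit_exp (t * of_int x)) \<le> 1 / \<bar>sin (pi * t)\<bar>"
proof (cases "i \<le> j")
  case True
  have "(unit_exp t - 1) * (\<Sum>x=i..j. unit_exp (t * of_int x))
      = (\<Sum>x=i..j. unit_exp (t * of_int (x + 1)) - unit_exp (t * of_int x))"
    by (simp add: sum_distrib_left algebra_simps unit_exp_add)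
  also have "\<dots> = unit_exp (t * of_int (j + 1)) - unit_exp (t * of_int i)"
    using True by (rule sum_int_telescope)
  also have "norm \<dots> \<le> 2"
    using norm_triangle_ineq4[of "unit_exp (t * of_int (j + 1))" "unit_exp (t * of_int i)"] by simp
  finally have "2 * \<bar>sin (pi * t)\<bar> * norm (\<Sum>x=i..j. unit_exp (t * of_int x)) \<le> 2"
    by (simp add: norm_mult norm_unit_exp_minus_one)
  then show ?thesis using assms by (simp add: field_simps)
qed simp

text \<open>Concavity puts the sine above its chord on [0, 1/2]; the reflection t -> 1 - t covers
  the other half. The product t (1 - t) is convenient because its reciprocal splits as 1/t + 1/(1 -
  t), which leads to harmonic sums.\<close>

lemma sin_pi_ge:
  assumes "0 \<le> t" "t \<le> 1"
  shows "2 * (t * (1 - t)) \<le> sin (pi * t)"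
proof -
  have half: "2 * (t * (1 - t)) \<le> sin (pi * t)" if "0 \<le> t" "t \<le> 1/2" for t
  proof -
    have "concave_on {0..pi} (sin :: real \<Rightarrow> real)"
      by (rule f''_le0_imp_concave[where f' = cos and f'' = "\<lambda>x. - sin x"])
        (auto intro!: derivative_eq_intros sin_ge_zero)
    then have "(1 - 2*t) * sin 0 + (2*t) * sin (pi/2) \<le> sin ((1 - 2*t) *\<^sub>R 0 + (2*t) *\<^sub>R (pi/2))"
      using that by (intro concave_onD) auto
    then have "2 * t \<le> sin (pi * t)" by (simp add: mult.commute)
    moreover have "t * (1 - t) \<le> t" using that by (simp add: algebra_simps)
    ultimately show ?thesis by linarith
  qed
  show ?thesis
  proof (cases "t \<le> 1/2")
    case False
    have "2 * ((1 - t) * (1 - (1 - t))) \<le> sin (pi * (1 - t))"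
      using False assms by (intro half) auto
    also have "sin (pi * (1 - t)) = sin (pi * t)" by (simp add: right_diff_distrib)
    finally show ?thesis by (simp add: mult.commute)
  qed (use half assms in auto)
qed

text \<open>Bounds a geometric sum of at most \<open>N\<close> terms with ratio \<open>exp (2 \<pi> i r / m)\<close>.\<close>

definition geom_bound :: "int \<Rightarrow> real \<Rightarrow> int \<Rightarrow> real" where
  "geom_bound m N r = (if m dvd r then N
     else m / 2 * (1 / (r mod m) + 1 / (m - r mod m)))"

lemma geom_bound_nonneg: "0 < m \<Longrightarrow> 0 \<le> N \<Longrightarrow> 0 \<le> geom_bound m N r"
  using pos_mod_bound[of m r] by (auto simp: geom_bound_def less_imp_le intro!: mult_nonneg_nonneg add_nonneg_nonneg)

text \<open>Changing \<open>r\<close> by a multiple of \<open>m\<close> changes no term, so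
  \<open>r\<close> may be replaced by its residue \<open>s\<close>; for \<open>s\<close> nonzero the
  telescoped bound applies at t = s/m. The assumption \<open>0 \<le> N\<close> covers empty
  ranges.\<close>

lemma norm_sum_unit_exp_frac_le:
  assumes m: "0 < m" and N: "real_of_int (j + 1 - i) \<le> N" "0 \<le> N"
  shows "norm (\<Sum>x=i..j. unit_exp (of_int (r * x) / of_int m)) \<le> geom_bound m N r"
proof (cases "m dvd r")
  case True
  have "norm (\<Sum>x=i..j. unit_exp (of_int (r * x) / of_int m)) \<le> (\<Sum>x=i..j. 1)"
    by (rule sum_norm_le) simp
  also have "\<dots> \<le> N" using N by (auto simp: of_nat_nat)
  finally show ?thesis using True by (simp add: geom_bound_def)
next
  case False
  define s where "s = r mod m"
  have s: "0 < s" "s < m"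
    using False m pos_mod_bound[of m r] pos_mod_sign[of m r]
    by (auto simp: s_def dvd_eq_mod_eq_0 less_le)
  have eq: "unit_exp (of_int (r * x) / of_int m) = unit_exp (of_int s / of_int m * of_int x)" for x
  proof -
    have "r = m * (r div m) + s" by (simp add: s_def)
    then have "real_of_int r = of_int m * of_int (r div m) + of_int s"
      by (metis of_int_add of_int_mult)
    then have "real_of_int (r * x) / of_int m = of_int s / of_int m * of_int x + of_int (r div m * x)"
      using m by (simp add: field_simps)
    then show ?thesis by (simp only: unit_exp_add unit_exp_of_int)  simp
  qed
  define t where "t = real_of_int s / of_int m"
  have t: "0 < t" "t < 1" using s m by (auto simp: t_def)
  have pos: "0 < 2 * (t * (1 - t))" using t by simp
  have ge: "2 * (t * (1 - t)) \<le> sin (pi * t)" using t by (intro sin_pi_ge) auto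
  have "norm (\<Sum>x=i..j. unit_exp (t * of_int x)) \<le> 1 / \<bar>sin (pi * t)\<bar>"
    using pos ge by (intro norm_sum_unit_exp_le) auto
  also have "\<dots> \<le> 1 / (2 * (t * (1 - t)))"
    using pos ge by (intro divide_left_mono) (auto intro: mult_pos_pos)
  \<comment> \<open>Partial fractions: 1 / (t (1 - t)) = 1/t + 1/(1 - t).\<close>
  also have "\<dots> = m / 2 * (1 / s + 1 / (m - s))"
    using s m by (simp add: t_def divide_simps)
  also have "\<dots> = geom_bound m N r" using False by (simp add: geom_bound_def s_def)
  finally show ?thesis by (simp only: eq t_def)
qed

text \<open>Orthogonality of additive characters, used to detect divisibility by \<open>m\<close>.
  For a ratio \<open>?w\<close> other than 1, multiplication by \<open>?w - 1\<close> telescopes the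
  sum to 1 - 1.\<close>

lemma sum_unit_exp_complete:
  assumes "0 < m"
  shows "(\<Sum>h=0..m-1. unit_exp (of_int (h * x) / of_int m)) = (if m dvd x then of_int m else 0)"
proof (cases "m dvd x")
  case True
  then obtain y where "x = m * y" by auto
  then have "unit_exp (of_int (h * x) / of_int m) = 1" for h
    using assms unit_exp_of_int[of "h * y"] by simp
  then show ?thesis using True assms by simp
next
  case False
  let ?w = "unit_exp (of_int x / of_int m)"
  have "sin (pi * (of_int x / of_int m)) \<noteq> 0"
  proof
    assume "sin (pi * (of_int x / of_int m)) = 0"
    then obtain i where "pi * (of_int x / of_int m) = of_int i * pi"
      using sin_zero_iff_int2 by blast
    then have "real_of_int x = of_int (i * m)" using assms by (simp add: field_simps)
    then have "x = i * m" by linarith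
    then show False using False by simp
  qed
  then have "?w - 1 \<noteq> 0"
    using norm_unit_exp_minus_one[of "of_int x / of_int m"] by force
  moreover have "(?w - 1) * (\<Sum>h=0..m-1. unit_exp (of_int (h * x) / of_int m)) = 0"
  proof -
    have "(?w - 1) * (\<Sum>h=0..m-1. unit_exp (of_int (h * x) / of_int m))
        = (\<Sum>h=0..m-1. unit_exp (of_int ((h + 1) * x) / of_int m) - unit_exp (of_int (h * x) / of_int m))"
      by (simp add: sum_distrib_left algebra_simps unit_exp_add add_divide_distrib)
    also have "\<dots> = unit_exp (of_int ((m - 1 + 1) * x) / of_int m) - unit_exp (of_int (0 * x) / of_int m)"
      using assms by (intro sum_int_telescope) auto
    also have "\<dots> = 0" using assms using unit_exp_of_int[of x] unit_exp_of_int[of 0] by simp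
    finally show ?thesis .
  qed
  ultimately show ?thesis using False by simp
qed

subsection \<open>Incomplete quadratic Gauss sums\<close>

text \<open>Weyl differencing: squaring the sum turns the quadratic phase into linear ones.\<close>

lemma norm_quadratic_sum_le:
  fixes m h n :: int
  assumes m: "0 < m" and n: "0 \<le> n"
  shows "(norm (\<Sum>b=-n..n. unit_exp (of_int (h * b\<^sup>2) / of_int (2 * m))))\<^sup>2
    \<le> (\<Sum>k=-2*n..2*n. geom_bound m (2 * n + 1) (h * k))"
proof -
  let ?e = "\<lambda>x::int. unit_exp (of_int (h * x) / of_int (2 * m))"
  let ?S = "\<Sum>b=-n..n. ?e (b\<^sup>2)"
  \<comment> \<open>\<open>?J k\<close> is the set of \<open>c\<close> for which both
    \<open>c\<close> and \<open>c + k\<close> lie in \<open>{-n..n}\<close>.\<close>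
  let ?J = "\<lambda>k. {max (-n) (-n-k)..min n (n-k)}"
  have e_mult: "?e x * cnj (?e y) = ?e (x - y)" for x y
    by (simp add: cnj_unit_exp algebra_simps diff_divide_distrib flip: unit_exp_add)
  have "of_real ((norm ?S)\<^sup>2) = ?S * cnj ?S" by (rule complex_norm_square)
  also have "\<dots> = (\<Sum>b=-n..n. \<Sum>c=-n..n. ?e (b\<^sup>2) * cnj (?e (c\<^sup>2)))"
    by (simp only: cnj_sum sum_product)
  also have "\<dots> = (\<Sum>b=-n..n. \<Sum>c=-n..n. ?e (b\<^sup>2 - c\<^sup>2))" by (simp only: e_mult)
  also have "\<dots> = (\<Sum>(b,c)\<in>{-n..n} \<times> {-n..n}. ?e (b\<^sup>2 - c\<^sup>2))"
    by (rule sum.cartesian_product)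
  \<comment> \<open>With b = c + k the phase b^2 - c^2 = k^2 + 2kc is linear in
    \<open>c\<close>.\<close>
  also have "\<dots> = (\<Sum>(k,c)\<in>(SIGMA k:{-2*n..2*n}. ?J k). ?e (k\<^sup>2 + 2 * k * c))"
    by (rule sum.reindex_bij_witness[of _ "\<lambda>(k,c). (c + k, c)" "\<lambda>(b,c). (b - c, c)"])
      (auto simp: power2_eq_square algebra_simps)
  also have "\<dots> = (\<Sum>k=-2*n..2*n. \<Sum>c\<in>?J k. ?e (k\<^sup>2 + 2 * k * c))"
    by (rule sum.Sigma[symmetric]) auto
  finally have eq: "complex_of_real ((norm ?S)\<^sup>2) = (\<Sum>k=-2*n..2*n. \<Sum>c\<in>?J k. ?e (k\<^sup>2 + 2 * k * c))" .
  have "(norm ?S)\<^sup>2 = norm (complex_of_real ((norm ?S)\<^sup>2))" by (simp only: norm_of_real abs_power2)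
  also have "\<dots> = norm (\<Sum>k=-2*n..2*n. \<Sum>c\<in>?J k. ?e (k\<^sup>2 + 2 * k * c))" by (simp only: eq)
  also have "\<dots> \<le> (\<Sum>k=-2*n..2*n. geom_bound m (2 * n + 1) (h * k))"
  proof (rule sum_norm_le)
    fix k
    \<comment> \<open>The factor 2 in 2kc cancels against the modulus \<open>2 * m\<close>: up to a
      unit factor the inner sum is geometric modulo \<open>m\<close> with frequency
      \<open>h * k\<close>.\<close>
    have "?e (k\<^sup>2 + 2 * k * c) = ?e (k\<^sup>2) * unit_exp (of_int (h * k * c) / of_int m)" for c
      using m by (simp add: field_simps flip: unit_exp_add)
    then have "norm (\<Sum>c\<in>?J k. ?e (k\<^sup>2 + 2 * k * c))
        = norm (\<Sum>c\<in>?J k. unit_exp (of_int (h * k * c) / of_int m))"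
      by (simp add: norm_mult flip: sum_distrib_left)
    also have "\<dots> \<le> geom_bound m (2 * n + 1) (h * k)"
      using m n by (intro norm_sum_unit_exp_frac_le) auto
    finally show "norm (\<Sum>c\<in>?J k. ?e (k\<^sup>2 + 2 * k * c)) \<le> geom_bound m (2 * n + 1) (h * k)" .
  qed
  finally show ?thesis .
qed

text \<open>The bound depends on the frequency and modulus only through their quotient, so a common
  factor cancels. This reduces to a frequency coprime to the modulus.\<close>

lemma geom_bound_gcd:
  assumes "0 < g" "0 < q"
  shows "geom_bound (g * q) N (g * r) = geom_bound q N r"
proof -
  have "real_of_int (g * q) / 2 * (1 / real_of_int (g * s) + 1 / (g * q - g * s))
      = real_of_int q / 2 * (1 / s + 1 / (q - s))" for s
  proof -
    have "real_of_int g * q - g * s = g * real_of_int (q - s)" by (simp add: algebra_simps)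
    then show ?thesis using assms by (simp add: distrib_left)
  qed
  then show ?thesis
    using assms by (simp add: geom_bound_def mult_mod_right[symmetric])
qed

lemma geom_bound_mod: "geom_bound q N (r mod q) = geom_bound q N r"
  by (simp add: geom_bound_def dvd_mod_iff)

text \<open>Multiplication by a unit permutes the residues modulo \<open>q\<close>, and
  \<open>q\<close> consecutive integers represent each residue once.\<close>

lemma sum_coprime_block:
  fixes q r i :: int
  assumes q: "0 < q" and cop: "coprime r q"
  shows "(\<Sum>k=i..i+q-1. f ((r * k) mod q)) = (\<Sum>s=0..q-1. f s)"
proof -
  let ?g = "\<lambda>k. (r * k) mod q"
  have inj: "inj_on ?g {i..i+q-1}"
  proof (rule inj_onI)
    fix x y assume xy: "x \<in> {i..i+q-1}" "y \<in> {i..i+q-1}" and eq: "?g x = ?g y"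
    have "q dvd r * (x - y)" using eq by (simp add: mod_eq_dvd_iff right_diff_distrib)
    then have "q dvd x - y" using cop by (simp add: coprime_dvd_mult_right_iff coprime_commute)
    moreover have "\<bar>x - y\<bar> < q" using xy by auto
    ultimately show "x = y" using zdvd_imp_le[of q "\<bar>x - y\<bar>"] by fastforce
  qed
  have "?g ` {i..i+q-1} = {0..q-1}"
  proof (rule card_subset_eq)
    show "?g ` {i..i+q-1} \<subseteq> {0..q-1}" using q by (auto simp: pos_mod_bound zle_diff1_eq)
    show "card (?g ` {i..i+q-1}) = card {0..q-1}" using inj by (simp add: card_image)
  qed simp
  then show ?thesis using sum.reindex[OF inj, of f] by simp
qed

lemma sum_coprime_blocks:
  fixes q r i :: int
  assumes q: "0 < q" and cop: "coprime r q"
  shows "(\<Sum>k=i..i + int t * q - 1. f ((r * k) mod q)) = of_nat t * (\<Sum>s=0..q-1. f s :: real)"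
proof (induction t)
  case (Suc t)
  have "{i..i + int (Suc t) * q - 1} = {i..i + int t * q - 1} \<union> {i + int t * q..i + int t * q + q - 1}"
  proof -
    define u where "u = int t * q"
    have "0 \<le> u" using q by (simp add: u_def)
    moreover have "int (Suc t) * q = u + q" by (simp add: u_def algebra_simps)
    ultimately show ?thesis unfolding u_def[symmetric] using q by auto
  qed
  moreover have "{i..i + int t * q - 1} \<inter> {i + int t * q..i + int t * q + q - 1} = {}" by auto
  ultimately show ?case
    using Suc sum_coprime_block[OF q cop, where i = "i + int t * q" and f = f]
    by (simp add: sum.union_disjoint algebra_simps)
qed simp

lemma sum_inverse_le_ln:
  fixes n :: int
  assumes "1 \<le> n"
  shows "(\<Sum>k=1..n. 1 / real_of_int k) \<le> 1 + ln n"
  using assms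
proof (induction n rule: int_ge_induct)
  case (step n)
  have "ln (n / (n + 1)) \<le> n / (n + 1) - 1" using step by (intro ln_le_minus_one) auto
  then have "1 / (n + 1) \<le> ln (real_of_int (n + 1)) - ln n"
    using step by (simp add: ln_div field_simps)
  moreover have "{1..n + 1} = insert (n + 1) {1..n}" using step by auto
  ultimately show ?case using step by simp
qed simp

text \<open>The residue 0 contributes \<open>N\<close>. The others give two harmonic sums, which
  agree under s -> q - s.\<close>

lemma sum_geom_bound_period_le:
  fixes q :: int
  assumes q: "0 < q"
  shows "(\<Sum>s=0..q-1. geom_bound q N s) \<le> N + q * (1 + ln q)"
proof -
  have "{0..q-1} = insert 0 {1..q-1}" using q by auto
  then have "(\<Sum>s=0..q-1. geom_bound q N s) = N + (\<Sum>s=1..q-1. geom_bound q N s)"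
    by (simp add: geom_bound_def)
  also have "(\<Sum>s=1..q-1. geom_bound q N s) = (\<Sum>s=1..q-1. q / 2 * (1 / s + 1 / (q - s)))"
    by (rule sum.cong) (auto simp: geom_bound_def zdvd_not_zless)
  also have "\<dots> = q / 2 * ((\<Sum>s=1..q-1. 1 / real_of_int s) + (\<Sum>s=1..q-1. 1 / real_of_int (q - s)))"
    by (simp add: sum_distrib_left sum.distrib distrib_left)
  also have "(\<Sum>s=1..q-1. 1 / real_of_int (q - s)) = (\<Sum>s=1..q-1. 1 / real_of_int s)"
    by (rule sum.reindex_bij_witness[of _ "\<lambda>s. q - s" "\<lambda>s. q - s"]) auto
  also have "q / 2 * ((\<Sum>s=1..q-1. 1 / real_of_int s) + (\<Sum>s=1..q-1. 1 / real_of_int s))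
      = q * (\<Sum>s=1..q-1. 1 / real_of_int s)" by simp
  also have "\<dots> \<le> q * (\<Sum>s=1..q. 1 / real_of_int s)"
    using q by (intro mult_left_mono sum_mono2) auto
  also have "\<dots> \<le> q * (1 + ln q)" using q by (intro mult_left_mono sum_inverse_le_ln) auto
  finally show ?thesis by simp
qed

text \<open>Removing g from \<open>h\<close> and \<open>m\<close> leaves \<open>h'\<close> coprime
  to \<open>q\<close>, so the differenced sum can be covered by complete residue systems modulo
  \<open>q\<close>, each costing at most N + q (1 + ln q). The assumption
  \<open>m \<le> 2 * n + 1\<close> gives q <= N, which keeps the number of periods O(N / q).\<close>

lemma norm_quadratic_sum_le_gcd:
  fixes m h n :: int
  assumes m: "0 < m" "m \<le> 2 * n + 1"
  defines "N \<equiv> real_of_int (2 * n + 1)"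
  shows "norm (\<Sum>b=-n..n. unit_exp (of_int (h * b\<^sup>2) / of_int (2 * m)))
    \<le> 2 * (N * sqrt (gcd h m / m) + sqrt (N * (1 + ln N)))"
proof -
  define g where "g = gcd h m"
  have g: "0 < g" using m by (simp add: g_def)
  define h' q where "h' = h div g" and "q = m div g"
  have hq: "h = g * h'" "m = g * q" "coprime h' q"
    using m div_gcd_coprime[of h m] by (auto simp: g_def h'_def q_def)
  have q: "0 < q" using m g hq by (simp add: zero_less_mult_iff)
  have "q \<le> m" using g q hq by simp
  then have qN: "real_of_int q \<le> N" using m by (simp add: N_def)
  have n: "0 \<le> n" using m by simp
  have N1: "1 \<le> N" using n by (simp add: N_def)
  \<comment> \<open>The range of \<open>k\<close> has 4n + 1 elements, so it is covered by
    \<open>t\<close> periods as soon as 4n < tq.\<close>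
  define t where "t = nat ((4 * n) div q + 1)"
  have t_int: "int t = (4 * n) div q + 1" using n q by (simp add: t_def pos_imp_zdiv_nonneg_iff)
  have tq: "4 * n < int t * q"
  proof -
    have "4 * n < q + 4 * n div q * q"
      using pos_mod_bound[OF q, of "4 * n"] div_mult_mod_eq[of "4 * n" q] by linarith
    then show ?thesis by (simp add: t_int algebra_simps)
  qed
  \<comment> \<open>tq <= 4n + q, where 4n <= 2N and q <= N.\<close>
  have t_le: "real t \<le> 3 * N / q"
  proof -
    have "(4 * n) div q * q \<le> 4 * n"
      using q pos_mod_sign[OF q, of "4 * n"] div_mult_mod_eq[of "4 * n" q] by linarith
    then have "int t * q \<le> 4 * n + q" using t_int by (simp add: algebra_simps)
    then have "real_of_int (int t * q) \<le> real_of_int (4 * n + q)" by (simp only: of_int_le_iff)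
    then have "real t * q \<le> 4 * n + q" by simp
    also have "\<dots> \<le> 3 * N" using qN by (simp add: N_def)
    finally show ?thesis using q by (simp add: field_simps)
  qed
  have "(norm (\<Sum>b=-n..n. unit_exp (of_int (h * b\<^sup>2) / of_int (2 * m))))\<^sup>2
      \<le> (\<Sum>k=-2*n..2*n. geom_bound m N (h * k))"
    unfolding N_def using m n by (intro norm_quadratic_sum_le) auto
  also have "\<dots> = (\<Sum>k=-2*n..2*n. geom_bound q N ((h' * k) mod q))"
    using g q by (simp add: hq geom_bound_gcd geom_bound_mod mult.assoc)
  also have "\<dots> \<le> (\<Sum>k=-2*n..-2*n + int t * q - 1. geom_bound q N ((h' * k) mod q))"
    using q N1 tq by (intro sum_mono2 geom_bound_nonneg) auto
  also have "\<dots> = t * (\<Sum>s=0..q-1. geom_bound q N s)"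
    by (rule sum_coprime_blocks) (use q hq in auto)
  also have "\<dots> \<le> 3 * N / q * (N + q * (1 + ln N))"
  proof (rule mult_mono)
    have "(\<Sum>s=0..q-1. geom_bound q N s) \<le> N + q * (1 + ln q)"
      using q by (rule sum_geom_bound_period_le)
    also have "\<dots> \<le> N + q * (1 + ln N)" using q qN by simp
    finally show "(\<Sum>s=0..q-1. geom_bound q N s) \<le> N + q * (1 + ln N)" .
    show "0 \<le> (\<Sum>s=0..q-1. geom_bound q N s)" using q N1 by (intro sum_nonneg geom_bound_nonneg) auto
  qed (use t_le q N1 in auto)
  also have "\<dots> = 3 * (N\<^sup>2 * (g / m) + N * (1 + ln N))"
    using q g by (simp add: hq field_simps power2_eq_square)
  \<comment> \<open>3 (x^2 + y^2) <= (2 (x + y))^2 for nonnegative x and y; this prepares taking the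
    square root.\<close>
  also have "\<dots> \<le> (2 * (N * sqrt (g / m) + sqrt (N * (1 + ln N))))\<^sup>2"
  proof -
    have "(2 * (x + y))\<^sup>2 \<ge> 3 * (x\<^sup>2 + y\<^sup>2)" if "0 \<le> x" "0 \<le> y" for x y :: real
      using that by (simp add: power2_eq_square algebra_simps)
    from this[of "N * sqrt (g / m)" "sqrt (N * (1 + ln N))"] show ?thesis
      using N1 g m by (simp add: power_mult_distrib)
  qed
  finally show ?thesis unfolding g_def
    by (rule power2_le_imp_le) (use N1 m in \<open>auto intro!: add_nonneg_nonneg\<close>)
qed

subsection \<open>Lattice points with small discriminant over a fixed leading coefficient\<close>

text \<open>Trading \<open>c\<close> for the discriminant \<open>d\<close> turns the region into a
  box, at the price of a congruence modulo \<open>4 * a\<close>.\<close>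

lemma bij_betw_discrim_strip:
  fixes a n D :: int
  assumes "0 < a"
  shows "bij_betw (\<lambda>(b, c). (b, b\<^sup>2 - 4 * a * c)) {(b, c). \<bar>b\<bar> \<le> n \<and> \<bar>b\<^sup>2 - 4 * a * c\<bar> \<le> D}
      {(b, d) \<in> {-n..n} \<times> {-D..D}. 4 * a dvd b\<^sup>2 - d}"
  by (rule bij_betwI[where g = "\<lambda>(b, d). (b, (b\<^sup>2 - d) div (4 * a))"])
    (use assms in \<open>auto simp: abs_le_iff\<close>)

lemma finite_discrim_strip:
  fixes a n D :: int
  assumes "0 < a"
  shows "finite {(b, c). \<bar>b\<bar> \<le> n \<and> \<bar>b\<^sup>2 - 4 * a * c\<bar> \<le> D}"
proof -
  have "finite {(b, d) \<in> {-n..n} \<times> {-D..D}. 4 * a dvd b\<^sup>2 - d}"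
    by (rule finite_subset[of _ "{-n..n} \<times> {-D..D}"]) auto
  then show ?thesis using bij_betw_finite[OF bij_betw_discrim_strip[OF assms]] by simp
qed

text \<open>The frequency \<open>h = 0\<close> gives the main term.\<close>

lemma card_discrim_strip_fourier:
  fixes a n D :: int
  assumes a: "0 < a" and n: "0 \<le> n" and D: "0 \<le> D"
  defines "m \<equiv> 4 * a"
  shows "of_int m * of_nat (card {(b, c). \<bar>b\<bar> \<le> n \<and> \<bar>b\<^sup>2 - 4 * a * c\<bar> \<le> D})
    = of_int ((2 * n + 1) * (2 * D + 1))
      + (\<Sum>h=1..m-1. (\<Sum>b=-n..n. unit_exp (of_int (h * b\<^sup>2) / of_int m))
        * (\<Sum>d=-D..D. unit_exp (of_int (- h * d) / of_int m)))"
proof -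
  let ?P = "{-n..n} \<times> {-D..D}"
  let ?F = "\<lambda>h. (\<Sum>b=-n..n. unit_exp (of_int (h * b\<^sup>2) / of_int m))
        * (\<Sum>d=-D..D. unit_exp (of_int (- h * d) / of_int m))"
  have m: "0 < m" using a by (simp add: m_def)
  have "of_int m * of_nat (card {(b, d) \<in> ?P. m dvd b\<^sup>2 - d})
      = (\<Sum>x\<in>{(b, d) \<in> ?P. m dvd b\<^sup>2 - d}. complex_of_int m)" by simp
  also have "\<dots> = (\<Sum>(b, d)\<in>?P. if m dvd b\<^sup>2 - d then of_int m else 0)"
    by (rule sum.mono_neutral_cong_left) (auto split: if_splits)
  \<comment> \<open>Orthogonality expands \<open>m\<close> times the indicator of the congruence
    over all frequencies.\<close>
  also have "\<dots> = (\<Sum>(b, d)\<in>?P. \<Sum>h=0..m-1. unit_exp (of_int (h * (b\<^sup>2 - d)) / of_int m))"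
    by (simp only: sum_unit_exp_complete[OF m])
  also have "\<dots> = (\<Sum>h=0..m-1. \<Sum>(b, d)\<in>?P. unit_exp (of_int (h * (b\<^sup>2 - d)) / of_int m))"
    unfolding case_prod_unfold by (rule sum.swap)
  also have "\<dots> = (\<Sum>h=0..m-1. ?F h)"
  proof (rule sum.cong)
    fix h
    have split: "unit_exp (of_int (h * (b\<^sup>2 - d)) / of_int m)
        = unit_exp (of_int (h * b\<^sup>2) / of_int m) * unit_exp (of_int (- h * d) / of_int m)" for b d
      by (simp add: algebra_simps diff_divide_distrib flip: unit_exp_add)
    show "(\<Sum>(b, d)\<in>?P. unit_exp (of_int (h * (b\<^sup>2 - d)) / of_int m)) = ?F h"
      unfolding split sum_product by (rule sum.cartesian_product[symmetric])
  qed simp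
  also have "{0..m-1} = insert 0 {1..m-1}" using m by auto
  also have "(\<Sum>h\<in>insert 0 {1..m-1}. ?F h) = ?F 0 + (\<Sum>h=1..m-1. ?F h)" by simp
  also have "?F 0 = of_int ((2 * n + 1) * (2 * D + 1))"
    using n D unit_exp_of_int[of 0] by (simp add: of_nat_nat)
  finally show ?thesis unfolding m_def using bij_betw_same_card[OF bij_betw_discrim_strip[OF a]] by simp
qed

text \<open>The nonzero frequencies are the error. Weyl's bound applies with 2a as its
  \<open>m\<close>, the condition 2a <= 2n + 1 following from \<open>a \<le> n\<close>; the
  geometric sums over \<open>d\<close> supply the weights 1/h, with a bound that does not depend on
  \<open>D\<close>.\<close>

lemma card_discrim_strip_approx:
  fixes a n D :: int and N :: real
  assumes a: "0 < a" and n: "a \<le> n" and D: "0 \<le> D"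
  defines "N \<equiv> real_of_int (2 * n + 1)"
  shows "\<bar>real (card {(b, c). \<bar>b\<bar> \<le> n \<and> \<bar>b\<^sup>2 - 4 * a * c\<bar> \<le> D}) - N * (2 * D + 1) / (4 * a)\<bar>
    \<le> (\<Sum>h=1..4*a-1. 2 * (N * sqrt (gcd h (2 * a) / (2 * a)) + sqrt (N * (1 + ln N))) / h)"
proof -
  define m where "m = 4 * a"
  let ?S = "\<lambda>h. \<Sum>b=-n..n. unit_exp (of_int (h * b\<^sup>2) / of_int m)"
  let ?G = "\<lambda>h. \<Sum>d=-D..D. unit_exp (of_int (- h * d) / of_int m)"
  let ?W = "\<lambda>h::int. 2 * (N * sqrt (gcd h (2 * a) / (2 * a)) + sqrt (N * (1 + ln N)))"
  let ?K = "real (card {(b, c). \<bar>b\<bar> \<le> n \<and> \<bar>b\<^sup>2 - 4 * a * c\<bar> \<le> D})"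
  have m: "0 < m" using a by (simp add: m_def)
  have N: "1 \<le> N" using a n by (simp add: N_def)
  have S: "norm (?S h) \<le> ?W h" for h
    using norm_quadratic_sum_le_gcd[of "2 * a" n h] a n by (simp add: N_def m_def)
  have G: "norm (?G h) \<le> m / 2 * (1 / h + 1 / (m - h))" if h: "h \<in> {1..m-1}" for h
  proof -
    have "norm (?G h) \<le> geom_bound m (2 * D + 1) (- h)"
      using m D by (intro norm_sum_unit_exp_frac_le) auto
    \<comment> \<open>The residue of -h is m - h, which merely swaps the two reciprocals.\<close>
    also have "\<dots> = m / 2 * (1 / h + 1 / (m - h))"
      using h by (simp add: geom_bound_def zmod_zminus1_eq_if zdvd_not_zless)
    finally show ?thesis .
  qed
  define K where "K = ?K"
  have K: "of_int m * of_real K - of_real (N * (2 * D + 1)) = (\<Sum>h=1..m-1. ?S h * ?G h)"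
  proof -
    have "of_int m * of_real K = of_real (N * (2 * D + 1)) + (\<Sum>h=1..m-1. ?S h * ?G h)"
      using card_discrim_strip_fourier[OF a _ D, of n] a n unfolding K_def N_def m_def by simp
    then show ?thesis by simp
  qed
  have "m * \<bar>K - N * (2 * D + 1) / (4 * a)\<bar> = \<bar>m * (K - N * (2 * D + 1) / (4 * a))\<bar>"
    using m by (simp add: abs_mult)
  also have "m * (K - N * (2 * D + 1) / (4 * a)) = m * K - N * (2 * D + 1)"
    using a by (simp add: m_def right_diff_distrib)
  also have "\<bar>\<dots>\<bar> = norm (complex_of_real (m * K - N * (2 * D + 1)))" by (simp only: norm_of_real)
  also have "\<dots> = norm (\<Sum>h=1..m-1. ?S h * ?G h)" unfolding K[symmetric] by simp
  also have "\<dots> \<le> (\<Sum>h=1..m-1. ?W h * (m / 2 * (1 / h + 1 / (m - h))))"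
  proof (rule sum_norm_le)
    fix h assume h: "h \<in> {1..m-1}"
    have "0 \<le> ?W h" using S[of h] norm_ge_zero order_trans by blast
    then show "norm (?S h * ?G h) \<le> ?W h * (m / 2 * (1 / h + 1 / (m - h)))"
      unfolding norm_mult by (intro mult_mono S G h norm_ge_zero)
  qed
  also have "\<dots> = m / 2 * ((\<Sum>h=1..m-1. ?W h / h) + (\<Sum>h=1..m-1. ?W h / (m - h)))"
    unfolding sum.distrib[symmetric] sum_distrib_left
    by (rule sum.cong) (simp_all only: algebra_simps divide_inverse mult_1)
  also have "(\<Sum>h=1..m-1. ?W h / (m - h)) = (\<Sum>h=1..m-1. ?W h / h)"
  proof (rule sum.reindex_bij_witness[of _ "\<lambda>h. m - h" "\<lambda>h. m - h"])
    fix h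
    \<comment> \<open>\<open>m\<close> is a multiple of 2a, so the Weyl bound is symmetric under h
      -> m - h.\<close>
    have "gcd (m - h) (2 * a) = gcd h (2 * a)"
      using gcd_add_mult[of "2 * a" 2 "- h"] by (simp add: m_def gcd.commute mult.commute)
    then show "?W (m - h) / (m - h) = ?W h / (m - h)" by simp
  qed auto
  finally have "m * \<bar>K - N * (2 * D + 1) / (4 * a)\<bar> \<le> m * (\<Sum>h=1..m-1. ?W h / h)" by simp
  then have "\<bar>K - N * (2 * D + 1) / (4 * a)\<bar> \<le> (\<Sum>h=1..m-1. ?W h / h)"
    using m by (simp only: mult_le_cancel_left_pos of_int_0_less_iff)
  then show ?thesis unfolding m_def K_def .
qed

subsection \<open>Sums involving greatest common divisors\<close>

text \<open>Each new term is at most an increment of the bound: 1/v <= 2v - 2u for v^2 = u^2 + 1,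
  because 2uv <= u^2 + v^2.\<close>

lemma sum_inverse_sqrt_le:
  fixes n :: int
  assumes "0 \<le> n"
  shows "(\<Sum>k=1..n. 1 / sqrt k) \<le> 2 * sqrt n"
  using assms
proof (induction n rule: int_ge_induct)
  case (step n)
  define u v where "u = sqrt n" and "v = sqrt (n + 1)"
  have uv: "0 \<le> u" "u \<le> v" "0 < v" "v\<^sup>2 = u\<^sup>2 + 1" using step by (auto simp: u_def v_def)
  have "2 * u * v \<le> u\<^sup>2 + v\<^sup>2" by (rule sum_squares_bound)
  then have "1 \<le> 2 * (v - u) * v" using uv by (simp add: algebra_simps power2_eq_square)
  then have "1 / v \<le> 2 * v - 2 * u" using uv by (simp add: field_simps)
  moreover have "{1..n + 1} = insert (n + 1) {1..n}" using step by auto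
  ultimately show ?case using step by (simp add: u_def v_def)
qed simp

text \<open>The term \<open>- 2 / sqrt n\<close> makes the induction work through 1/v^3 <= 2/u -
  2/v; the application uses only the uniform bound 3.\<close>

lemma sum_inverse_sqrt_cubed_le:
  fixes n :: int
  assumes "1 \<le> n"
  shows "(\<Sum>k=1..n. 1 / (k * sqrt k)) \<le> 3 - 2 / sqrt n"
  using assms
proof (induction n rule: int_ge_induct)
  case (step n)
  define u v where "u = sqrt n" and "v = sqrt (n + 1)"
  have uv: "0 < u" "u \<le> v" "v\<^sup>2 = u\<^sup>2 + 1" "n + 1 = v\<^sup>2" using step by (auto simp: u_def v_def)
  have "u * (u + v) \<le> v * (v + v)" using uv by (intro mult_mono) auto
  then have "u * (u + v) \<le> 2 * v\<^sup>2 * ((v - u) * (v + u))"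
    using uv by (simp add: algebra_simps power2_eq_square)
  then have "u * (u + v) \<le> (2 * v\<^sup>2 * (v - u)) * (u + v)" by (simp add: algebra_simps)
  then have "u \<le> 2 * v\<^sup>2 * (v - u)" using uv by simp
  then have "u / (u * v\<^sup>2 * v) \<le> 2 * v\<^sup>2 * (v - u) / (u * v\<^sup>2 * v)"
    using uv by (intro divide_right_mono) auto
  also have "2 * v\<^sup>2 * (v - u) / (u * v\<^sup>2 * v) = 2 / u - 2 / v"
    using uv(1,2) by (simp add: field_simps)
  also have "u / (u * v\<^sup>2 * v) = 1 / (v\<^sup>2 * v)" using uv(1) by simp
  finally have "1 / (v\<^sup>2 * v) \<le> 2 / u - 2 / v" .
  moreover have "{1..n + 1} = insert (n + 1) {1..n}" using step by auto
  ultimately show ?case using step by (simp add: u_def v_def)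
qed simp

lemma sum_multiples:
  fixes d X :: int
  assumes "0 < d"
  shows "(\<Sum>x=1..X. if d dvd x then f x else 0) = (\<Sum>j=1..X div d. f (d * j))"
proof -
  have "(\<Sum>x=1..X. if d dvd x then f x else 0) = (\<Sum>x\<in>{x\<in>{1..X}. d dvd x}. f x)"
    by (rule sum.inter_filter[symmetric]) simp
  also have "\<dots> = (\<Sum>j=1..X div d. f (d * j))"
  proof (rule sum.reindex_bij_witness[of _ "\<lambda>j. d * j" "\<lambda>x. x div d"])
    fix j assume j: "j \<in> {1..X div d}"
    have "d * j \<le> d * (X div d)" using j assms by simp
    also have "\<dots> \<le> X"
      using mult_div_mod_eq[of d X] pos_mod_sign[OF assms, of X] by linarith
    finally have "d * j \<le> X" .
    moreover have "1 \<le> d * j" using j assms by (simp add: int_one_le_iff_zero_less)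
    ultimately show "d * j \<in> {x\<in>{1..X}. d dvd x}" by simp
  qed (use assms in \<open>auto simp: zdiv_mono1 pos_imp_zdiv_pos_iff zdvd_imp_le int_one_le_iff_zero_less\<close>)
  finally show ?thesis .
qed

text \<open>Replacing the root of the gcd by the sum of sqrt d over all common divisors
  \<open>d\<close> separates \<open>n\<close> from \<open>h\<close>. The two inner sums each gain a
  factor 1/d, and the remaining sum of d^(-3/2) converges.\<close>

lemma sum_sqrt_gcd_le:
  fixes X H :: int
  assumes X: "1 \<le> X" and H: "1 \<le> H"
  shows "(\<Sum>n=1..X. \<Sum>h=1..H. sqrt (gcd h n / n) / h) \<le> 6 * sqrt X * (1 + ln H)"
proof -
  define u :: "int \<Rightarrow> int \<Rightarrow> real" where "u d n = (if d dvd n then 1 / sqrt n else 0)" for d n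
  define v :: "int \<Rightarrow> int \<Rightarrow> real" where "v d h = (if d dvd h then 1 / h else 0)" for d h
  have "(\<Sum>n=1..X. \<Sum>h=1..H. sqrt (gcd h n / n) / h)
      \<le> (\<Sum>n=1..X. \<Sum>h=1..H. \<Sum>d=1..X. sqrt d * (u d n * v d h))"
  proof (intro sum_mono)
    fix n h assume n: "n \<in> {1..X}" and h: "h \<in> {1..H}"
    let ?g = "gcd h n"
    have "?g \<le> n" using n by (intro gcd_le2_int) auto
    then have "?g \<le> X" using n by (meson atLeastAtMost_iff order_trans)
    then have g: "?g \<in> {1..X}" using n by (auto simp: int_one_le_iff_zero_less)
    have "sqrt (?g / n) / h = sqrt ?g * (u ?g n * v ?g h)"
      by (simp add: u_def v_def real_sqrt_divide)
    \<comment> \<open>The gcd is itself one of the \<open>d\<close>, and all summands are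
      nonnegative.\<close>
    also have "\<dots> \<le> (\<Sum>d=1..X. sqrt d * (u d n * v d h))"
      using g n h by (intro member_le_sum) (auto simp: u_def v_def)
    finally show "sqrt (?g / n) / h \<le> (\<Sum>d=1..X. sqrt d * (u d n * v d h))" .
  qed
  also have "\<dots> = (\<Sum>n=1..X. \<Sum>d=1..X. \<Sum>h=1..H. sqrt d * (u d n * v d h))"
    by (rule sum.cong[OF refl], rule sum.swap)
  also have "\<dots> = (\<Sum>d=1..X. \<Sum>n=1..X. \<Sum>h=1..H. sqrt d * (u d n * v d h))"
    by (rule sum.swap)
  also have "\<dots> = (\<Sum>d=1..X. sqrt d * ((\<Sum>n=1..X. u d n) * (\<Sum>h=1..H. v d h)))"
    by (simp only: sum_product) (simp only: sum_distrib_left)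
  also have "\<dots> \<le> (\<Sum>d=1..X. 2 * sqrt X * (1 + ln H) * (1 / (d * sqrt d)))"
  proof (rule sum_mono)
    fix d assume "d \<in> {1..X}"
    then have d: "1 \<le> d" by simp
    have "(\<Sum>n=1..X. u d n) = (\<Sum>j=1..X div d. 1 / sqrt (real_of_int (d * j)))"
      unfolding u_def v_def using d by (intro sum_multiples) auto
    also have "\<dots> = (\<Sum>j=1..X div d. 1 / sqrt j) / sqrt d"
      by (simp add: real_sqrt_mult sum_divide_distrib mult.commute)
    also have "\<dots> \<le> 2 * sqrt (X div d) / sqrt d"
      using d X by (intro divide_right_mono sum_inverse_sqrt_le) (auto simp: pos_imp_zdiv_nonneg_iff)
    also have "\<dots> \<le> 2 * sqrt (X / d) / sqrt d"
      by (intro divide_right_mono mult_left_mono real_sqrt_le_mono) (use d in \<open>auto intro: real_of_int_div4\<close>)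
    also have "\<dots> = 2 * sqrt X / d" using d by (simp add: real_sqrt_divide)
    finally have u_le: "(\<Sum>n=1..X. u d n) \<le> 2 * sqrt X / d" .
    have "(\<Sum>h=1..H. v d h) = (\<Sum>j=1..H div d. 1 / real_of_int (d * j))"
      unfolding u_def v_def using d by (intro sum_multiples) auto
    also have "\<dots> = (\<Sum>j=1..H div d. 1 / real_of_int j) / d"
      by (simp add: sum_divide_distrib mult.commute)
    also have "\<dots> \<le> (\<Sum>j=1..H. 1 / real_of_int j) / d"
      using d H by (intro divide_right_mono sum_mono2) (use zdiv_mono2[of H 1 d] in auto)
    also have "\<dots> \<le> (1 + ln H) / d" using d H by (intro divide_right_mono sum_inverse_le_ln) auto
    finally have v_le: "(\<Sum>h=1..H. v d h) \<le> (1 + ln H) / d" .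
    have "sqrt d * ((\<Sum>n=1..X. u d n) * (\<Sum>h=1..H. v d h)) \<le> sqrt d * (2 * sqrt X / d * ((1 + ln H) / d))"
      using u_le v_le d X by (intro mult_left_mono mult_mono) (auto simp: u_def v_def intro!: sum_nonneg)
    also have "\<dots> = 2 * sqrt X * (1 + ln H) * (1 / (d * sqrt d))"
    proof -
      have "w * (2 * sqrt X / w\<^sup>2 * ((1 + ln H) / w\<^sup>2)) = 2 * sqrt X * (1 + ln H) * (1 / (w\<^sup>2 * w))"
        if "0 < w" for w :: real
        using that by (simp add: field_simps power2_eq_square)
      from this[of "sqrt d"] show ?thesis using d by simp
    qed
    finally show "sqrt d * ((\<Sum>n=1..X. u d n) * (\<Sum>h=1..H. v d h)) \<le> \<dots>" .
  qed
  also have "\<dots> = 2 * sqrt X * (1 + ln H) * (\<Sum>d=1..X. 1 / (d * sqrt d))"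
    by (simp only: sum_distrib_left)
  also have "\<dots> \<le> 2 * sqrt X * (1 + ln H) * 3"
  proof (rule mult_left_mono)
    have "0 \<le> 2 / sqrt X" using X by simp
    then show "(\<Sum>d=1..X. 1 / (d * sqrt d)) \<le> 3"
      using sum_inverse_sqrt_cubed_le[OF X] by linarith
  qed (use X H in simp)
  finally show ?thesis by simp
qed

text \<open>By positivity the sum over even n = 2a extends to all n <= 2A, and the range of
  \<open>h\<close> to \<open>4 * A\<close>.\<close>

lemma sum_sqrt_gcd_double_le:
  fixes A :: int
  assumes A: "1 \<le> A"
  shows "(\<Sum>a=1..A. \<Sum>h=1..4*a-1. sqrt (gcd h (2 * a) / (2 * a)) / h) \<le> 6 * sqrt (2 * A) * (1 + ln (4 * A))"
proof -
  let ?f = "\<lambda>n::int. \<Sum>h=1..4*A. sqrt (gcd h n / n) / h"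
  have "(\<Sum>a=1..A. \<Sum>h=1..4*a-1. sqrt (gcd h (2 * a) / (2 * a)) / h) \<le> (\<Sum>a=1..A. ?f (2 * a))"
    by (intro sum_mono) (simp, intro sum_mono2, auto)
  also have "\<dots> = (\<Sum>n\<in>(\<lambda>a. 2 * a) ` {1..A}. ?f n)"
    by (subst sum.reindex) (auto simp: inj_on_def)
  also have "\<dots> \<le> (\<Sum>n=1..2*A. ?f n)"
    by (intro sum_mono2) (auto intro!: sum_nonneg)
  also have "\<dots> \<le> 6 * sqrt (2 * A) * (1 + ln (4 * A))"
    using sum_sqrt_gcd_le[of "2 * A" "4 * A"] A by simp
  finally show ?thesis .
qed

subsection \<open>The main term\<close>

text \<open>\<open>range_integral Q x\<close> is the integral of \<open>min Q (2 * sqrt (t * Q)) / t\<close> over \<open>0 < t < x\<close>; the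
  integrand is decreasing, so \<open>range_integral Q\<close> is concave.\<close>

definition range_integral :: "real \<Rightarrow> real \<Rightarrow> real" where
  "range_integral Q x = (if x \<le> Q / 4 then 4 * sqrt (x * Q) else 2 * Q + Q * ln (4 * x / Q))"

text \<open>A concave function lies below its tangent at \<open>y\<close>, whose slope is the
  integrand there. Each of the two formulas is treated on its own side of Q/4, where they meet with
  common slope 4.\<close>

lemma range_integral_tangent:
  assumes Q: "0 < Q" and x: "0 \<le> x" and y: "0 < y"
  shows "range_integral Q x \<le> range_integral Q y + min Q (2 * sqrt (y * Q)) / y * (x - y)"
proof -
  let ?F = "range_integral Q" and ?f = "\<lambda>y. min Q (2 * sqrt (y * Q)) / y" and ?z = "Q / 4"
  have F_high: "?F t = 2 * Q + Q * ln (4 * t / Q)" if "?z \<le> t" for t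
  proof (cases "t = ?z")
    case True
    then have "t * Q = (Q / 2)\<^sup>2" by (simp add: power2_eq_square)
    then have "sqrt (t * Q) = sqrt ((Q / 2)\<^sup>2)" by (simp only:)
    also have "\<dots> = Q / 2" using Q by (simp only: real_sqrt_abs)
    finally have "4 * sqrt (t * Q) = 2 * Q" by simp
    moreover have "4 * t / Q = 1" using True Q by simp
    ultimately show ?thesis using True by (simp only: range_integral_def) simp
  qed (use that in \<open>simp add: range_integral_def\<close>)
  have f_low: "?f t = 2 * sqrt (t * Q) / t" if "t \<le> ?z" "0 < t" for t
  proof -
    have "sqrt (t * Q) \<le> sqrt ((Q / 2)\<^sup>2)"
      using mult_right_mono[OF that(1), of Q] Q
      by (intro real_sqrt_le_mono) (simp add: power2_eq_square)
    then show ?thesis using Q by (simp add: min_def)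
  qed
  have f_high: "?f t = Q / t" if "?z \<le> t" for t
  proof -
    have "sqrt ((Q / 2)\<^sup>2) \<le> sqrt (t * Q)"
      using mult_right_mono[OF that, of Q] Q
      by (intro real_sqrt_le_mono) (simp add: power2_eq_square)
    then show ?thesis using Q by (simp add: min_def)
  qed
  have low: "?F x \<le> ?F y + ?f y * (x - y)" if "0 \<le> x" "x \<le> ?z" "0 < y" "y \<le> ?z" for x y
  proof -
    define u v w where "u = sqrt x" and "v = sqrt y" and "w = sqrt Q"
    have uvw: "0 \<le> u" "0 < v" "0 < w" "x = u\<^sup>2" "y = v\<^sup>2" using that Q by (auto simp: u_def v_def w_def)
    have "4 * (u * w) \<le> 4 * (v * w) + 2 * (v * w) / v\<^sup>2 * (u\<^sup>2 - v\<^sup>2)"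
    proof -
      \<comment> \<open>In terms of square roots, the gap between tangent and function is exactly
        this square.\<close>
      have "0 \<le> 2 * w / v * (u - v)\<^sup>2" using uvw by simp
      also have "\<dots> = 4 * (v * w) + 2 * (v * w) / v\<^sup>2 * (u\<^sup>2 - v\<^sup>2) - 4 * (u * w)"
        using uvw(2) by (simp add: field_simps power2_eq_square)
      finally show ?thesis by simp
    qed
    moreover have "?F x = 4 * (u * w)" "?F y = 4 * (v * w)" "?f y = 2 * (v * w) / v\<^sup>2"
      using that f_low[OF that(4,3)] by (simp_all add: range_integral_def real_sqrt_mult u_def v_def w_def)
    ultimately show ?thesis using uvw(2) by (simp add: uvw(4,5))
  qed
  have high: "?F x \<le> ?F y + ?f y * (x - y)" if "?z \<le> x" "?z \<le> y" for x y
  proof -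
    have pos: "0 < x" "0 < y" using that Q by linarith+
    have "ln (4 * x / Q) - ln (4 * y / Q) = ln (x / y)" using pos Q by (simp add: ln_mult ln_div)
    also have "\<dots> \<le> x / y - 1" using pos by (intro ln_le_minus_one) simp
    finally have "Q * (ln (4 * x / Q) - ln (4 * y / Q)) \<le> Q * (x / y - 1)"
      using Q by (intro mult_left_mono) auto
    moreover have "Q / y * (x - y) = Q * (x / y - 1)" using pos by (simp add: field_simps)
    ultimately show ?thesis
      unfolding F_high[OF that(1)] F_high[OF that(2)] f_high[OF that(2)] by (simp add: algebra_simps)
  qed
  \<comment> \<open>For \<open>x\<close> and \<open>y\<close> on opposite sides, two tangent bounds
    are chained through Q/4. Comparing the slope at \<open>y\<close> with 4 has the right direction
    in both cases.\<close>
  have split: "?f y * (x - y) = ?f y * (?z - y) + ?f y * (x - ?z)"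
    unfolding distrib_left[symmetric] by simp
  have f_z: "?f ?z = 4" using Q f_high[of ?z] by simp
  consider "x \<le> ?z" "y \<le> ?z" | "?z \<le> x" "?z \<le> y" | "x \<le> ?z" "?z \<le> y" | "?z \<le> x" "y \<le> ?z" by linarith
  then show ?thesis
  proof cases
    case 3
    have "?F x \<le> ?F ?z + 4 * (x - ?z)" using low[of x ?z, unfolded f_z] x 3 Q by simp
    moreover have "?F ?z \<le> ?F y + ?f y * (?z - y)" using high[of ?z y] 3 by simp
    moreover have "4 * (x - ?z) \<le> ?f y * (x - ?z)"
    proof (rule mult_right_mono_neg)
      show "?f y \<le> 4" using 3 y by (simp add: f_high field_simps)
    qed (use 3 in simp)
    ultimately show ?thesis using split by linarith
  next
    case 4
    have "?F x \<le> ?F ?z + 4 * (x - ?z)" using high[of x ?z, unfolded f_z] 4 by simp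
    moreover have "?F ?z \<le> ?F y + ?f y * (?z - y)" using low[of ?z y] 4 y Q by simp
    moreover have "4 * (x - ?z) \<le> ?f y * (x - ?z)"
    proof (rule mult_right_mono)
      have "4 * y \<le> 2 * sqrt (y * Q)"
      proof -
        have "(2 * y)\<^sup>2 \<le> y * Q" using 4 y by (simp add: power2_eq_square)
        then show ?thesis using real_le_rsqrt[of "2 * y" "y * Q"] by simp
      qed
      then show "4 \<le> ?f y" using 4 y by (simp only: f_low) (simp add: field_simps)
    qed (use 4 in simp)
    ultimately show ?thesis using split by linarith
  qed (use low high x y in auto)
qed

text \<open>Tangents at integers sandwich each summand between consecutive increments of
  \<open>range_integral\<close>. Telescoping gives F(Q) - F(0) above and F(Q+1) - F(1) below, so the
  error is at most F(1).\<close>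

lemma sum_range_approx:
  fixes Q :: int
  assumes Q: "1 \<le> Q"
  shows "\<bar>(\<Sum>a=1..Q. min (real_of_int Q) (2 * sqrt (a * Q)) / a) - 2 * Q * (1 + ln 2)\<bar> \<le> 6 * sqrt Q"
proof -
  let ?F = "\<lambda>a::int. range_integral Q a" and ?f = "\<lambda>a::int. min (real_of_int Q) (2 * sqrt (a * Q)) / a"
  have FQ: "?F Q = 2 * Q * (1 + ln 2)"
  proof -
    have "ln 4 = 2 * ln (2::real)" using ln_realpow[of 2 2] by simp
    then show ?thesis using Q by (simp add: range_integral_def algebra_simps)
  qed
  have F0: "?F 0 = 0" using Q by (simp add: range_integral_def)
  have "?f a \<le> ?F a - ?F (a - 1)" if "a \<in> {1..Q}" for a
    using range_integral_tangent[of Q "a - 1" a] that Q by simp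
  then have "(\<Sum>a=1..Q. ?f a) \<le> (\<Sum>a=1..Q. ?F a - ?F (a - 1))" by (rule sum_mono)
  also have "\<dots> = ?F Q - ?F 0" using sum_int_telescope[of 1 Q "\<lambda>a. ?F (a - 1)"] Q by simp
  finally have upper: "(\<Sum>a=1..Q. ?f a) \<le> ?F Q" using F0 by simp
  have "?F (a + 1) - ?F a \<le> ?f a" if "a \<in> {1..Q}" for a
    using range_integral_tangent[of Q "a + 1" a] that Q by simp
  then have "(\<Sum>a=1..Q. ?F (a + 1) - ?F a) \<le> (\<Sum>a=1..Q. ?f a)" by (rule sum_mono)
  also have "(\<Sum>a=1..Q. ?F (a + 1) - ?F a) = ?F (Q + 1) - ?F 1"
    using Q by (intro sum_int_telescope)
  finally have lower: "?F (Q + 1) - ?F 1 \<le> (\<Sum>a=1..Q. ?f a)" .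
  have "0 \<le> ?f (Q + 1)" using Q by simp
  moreover have "?F Q \<le> ?F (Q + 1) + ?f (Q + 1) * (Q - (Q + 1))"
    using range_integral_tangent[of Q Q "Q + 1"] Q by simp
  ultimately have FQ1: "?F Q \<le> ?F (Q + 1)" by simp
  \<comment> \<open>For Q >= 4 the value is 4 sqrt Q. For smaller \<open>Q\<close> the tangent at
    Q/4 gives Q + 4, and Q <= 2 sqrt Q.\<close>
  have F1: "?F 1 \<le> 6 * sqrt Q"
  proof (cases "1 \<le> real_of_int Q / 4")
    case False
    have "range_integral Q 1 \<le> range_integral Q (Q / 4) + min Q (2 * sqrt (Q / 4 * Q)) / (Q / 4) * (1 - Q / 4)"
      using range_integral_tangent[of Q 1 "Q / 4"] Q by simp
    also have "Q / 4 * Q = (real_of_int Q / 2)\<^sup>2" by (simp add: power2_eq_square)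
    then have "sqrt (Q / 4 * Q) = Q / 2" using Q by simp
    then have "range_integral Q (Q / 4) + min Q (2 * sqrt (Q / 4 * Q)) / (Q / 4) * (1 - Q / 4) = Q + 4"
      using Q by (simp add: range_integral_def field_simps)
    also have "Q + 4 \<le> 6 * sqrt Q"
    proof -
      have "1 \<le> sqrt Q" using Q by simp
      moreover have "sqrt Q \<le> sqrt (2\<^sup>2)" using False by (intro real_sqrt_le_mono) simp
      then have "sqrt Q * sqrt Q \<le> 2 * sqrt Q" using Q by (intro mult_right_mono) auto
      moreover have "sqrt Q * sqrt Q = Q" using Q by simp
      ultimately show ?thesis by linarith
    qed
    finally show ?thesis by simp
  qed (use Q in \<open>simp add: range_integral_def\<close>)
  have "0 \<le> sqrt Q" using Q by simp
  then show ?thesis using upper lower FQ1 F1 FQ by linarith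
qed

subsection \<open>Exchanging the height condition\<close>

lemma card_le_diameter:
  fixes S :: "int set"
  assumes fin: "finite S" and r: "0 \<le> r"
    and diam: "\<And>x z. x \<in> S \<Longrightarrow> z \<in> S \<Longrightarrow> x \<le> z \<Longrightarrow> real_of_int (z - x) \<le> r"
  shows "real (card S) \<le> r + 1"
proof (cases "S = {}")
  case False
  have "S \<subseteq> {Min S..Min S + \<lfloor>r\<rfloor>}"
  proof
    fix z assume z: "z \<in> S"
    have "Min S \<in> S" "Min S \<le> z" using fin False z by auto
    then have "z - Min S \<le> \<lfloor>r\<rfloor>" using diam[of "Min S" z] z by (simp add: le_floor_iff)
    then show "z \<in> {Min S..Min S + \<lfloor>r\<rfloor>}" using \<open>Min S \<le> z\<close> by auto
  qed
  then have "card S \<le> card {Min S..Min S + \<lfloor>r\<rfloor>}" by (intro card_mono) auto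
  then have "int (card S) \<le> \<lfloor>r\<rfloor> + 1" using r by (simp add: le_nat_iff)
  then have "real (card S) \<le> real_of_int (\<lfloor>r\<rfloor> + 1)" by linarith
  then show ?thesis by linarith
qed (use r in simp)

text \<open>Nonnegative members x <= z satisfy (z - x)^2 <= z^2 - x^2 <= 2D, so each sign
  contributes at most sqrt(2D) + 1 <= 3 sqrt D values, uniformly in \<open>y\<close>.\<close>

lemma card_square_window:
  fixes y D :: int
  assumes D: "1 \<le> D"
  shows "finite {b::int. \<bar>b\<^sup>2 - y\<bar> \<le> D}" and "real (card {b::int. \<bar>b\<^sup>2 - y\<bar> \<le> D}) \<le> 6 * sqrt D"
proof -
  define S where "S = {b::int. 0 \<le> b \<and> \<bar>b\<^sup>2 - y\<bar> \<le> D}"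
  have "S \<subseteq> {0..\<bar>y\<bar> + D}"
  proof
    fix b assume b: "b \<in> S"
    then have "b \<le> b\<^sup>2" by (cases "b = 0") (auto simp: S_def power2_eq_square)
    then show "b \<in> {0..\<bar>y\<bar> + D}" using b by (auto simp: S_def)
  qed
  then have fin: "finite S" by (rule finite_subset) simp
  have "real (card S) \<le> sqrt (2 * D) + 1"
  proof (rule card_le_diameter[OF fin])
    fix x z assume xz: "x \<in> S" "z \<in> S" "x \<le> z"
    have "0 \<le> x * (z - x)" using xz by (simp add: S_def)
    then have "(z - x)\<^sup>2 \<le> z\<^sup>2 - x\<^sup>2" by (simp add: power2_eq_square algebra_simps)
    also have "\<dots> \<le> 2 * D" using xz by (auto simp: S_def)
    finally have "real_of_int ((z - x)\<^sup>2) \<le> real_of_int (2 * D)" by (simp only: of_int_le_iff)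
    then show "real_of_int (z - x) \<le> sqrt (2 * D)" by (intro real_le_rsqrt) simp
  qed (use D in simp)
  also have "\<dots> \<le> 3 * sqrt D"
  proof -
    have "sqrt (2 * D) \<le> sqrt (2\<^sup>2 * D)" using D by (intro real_sqrt_le_mono) simp
    also have "\<dots> = 2 * sqrt D" by (simp add: real_sqrt_mult)
    finally have "sqrt (2 * D) \<le> 2 * sqrt D" .
    moreover have "1 \<le> sqrt D" using D by simp
    ultimately show ?thesis by linarith
  qed
  finally have card_S: "real (card S) \<le> 3 * sqrt D" .
  have eq: "{b::int. \<bar>b\<^sup>2 - y\<bar> \<le> D} = S \<union> uminus ` S"
  proof (intro equalityI subsetI)
    fix b assume b: "b \<in> {b::int. \<bar>b\<^sup>2 - y\<bar> \<le> D}"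
    show "b \<in> S \<union> uminus ` S"
    proof (cases "0 \<le> b")
      case False
      then have "- b \<in> S" using b by (simp add: S_def)
      then show ?thesis by (metis UnI2 image_eqI minus_minus)
    qed (use b in \<open>simp add: S_def\<close>)
  qed (auto simp: S_def)
  show "finite {b::int. \<bar>b\<^sup>2 - y\<bar> \<le> D}" using fin by (simp add: eq)
  have "card (S \<union> uminus ` S) \<le> card S + card S"
    using card_Un_le[of S "uminus ` S"] card_image_le[OF fin, of uminus] by linarith
  then have "real (card (S \<union> uminus ` S)) \<le> real (card S) + real (card S)" by linarith
  then show "real (card {b::int. \<bar>b\<^sup>2 - y\<bar> \<le> D}) \<le> 6 * sqrt D" using card_S by (simp only: eq)
qed

lemma card_discrim_window_fibre:
  fixes a b D :: int
  assumes a: "1 \<le> a" and D: "0 \<le> D"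
  shows "finite {c. \<bar>b\<^sup>2 - 4 * a * c\<bar> \<le> D}" and "real (card {c. \<bar>b\<^sup>2 - 4 * a * c\<bar> \<le> D}) \<le> D / (2 * a) + 1"
proof -
  have "{c. \<bar>b\<^sup>2 - 4 * a * c\<bar> \<le> D} \<subseteq> {-(b\<^sup>2 + D)..b\<^sup>2 + D}"
  proof
    fix c assume c: "c \<in> {c. \<bar>b\<^sup>2 - 4 * a * c\<bar> \<le> D}"
    have "1 * \<bar>c\<bar> \<le> (4 * a) * \<bar>c\<bar>" using a by (intro mult_right_mono) auto
    also have "\<dots> = \<bar>4 * a * c\<bar>" using a by (simp add: abs_mult)
    also have "\<dots> \<le> b\<^sup>2 + D" using c zero_le_power2[of b] unfolding mem_Collect_eq by linarith
    finally show "c \<in> {-(b\<^sup>2 + D)..b\<^sup>2 + D}" by auto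
  qed
  then show fin: "finite {c. \<bar>b\<^sup>2 - 4 * a * c\<bar> \<le> D}" by (rule finite_subset) simp
  show "real (card {c. \<bar>b\<^sup>2 - 4 * a * c\<bar> \<le> D}) \<le> D / (2 * a) + 1"
  proof (rule card_le_diameter[OF fin])
    fix x z assume "x \<in> {c. \<bar>b\<^sup>2 - 4 * a * c\<bar> \<le> D}" "z \<in> {c. \<bar>b\<^sup>2 - 4 * a * c\<bar> \<le> D}"
    then have "4 * a * z - 4 * a * x \<le> 2 * D" by auto
    then have "(z - x) * (2 * a) \<le> D" by (simp add: algebra_simps)
    then have "real_of_int ((z - x) * (2 * a)) \<le> D" by (simp only: of_int_le_iff)
    then show "real_of_int (z - x) \<le> D / (2 * a)" using a by (simp add: pos_le_divide_eq)
  qed (use a D in simp)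
qed

definition box_fibre :: "int \<Rightarrow> int \<Rightarrow> int \<Rightarrow> (int \<times> int) set" where
  "box_fibre Q D a = {(b, c). \<bar>b\<bar> \<le> Q \<and> \<bar>c\<bar> \<le> Q \<and> \<bar>b\<^sup>2 - 4 * a * c\<bar> \<le> D}"

lemma finite_box_fibre: "finite (box_fibre Q D a)"
  by (rule finite_subset[of _ "{-Q..Q} \<times> {-Q..Q}"]) (auto simp: box_fibre_def)

text \<open>The constraint on \<open>c\<close> may be traded for \<open>b\<^sup>2 \<le> 4 * a * Q\<close>: a point that satisfies only one
  of the two has \<open>b\<^sup>2\<close> within \<open>D\<close> of \<open>4 * a * Q\<close> or of \<open>0\<close>.\<close>

lemma card_box_fibre_approx_strip:
  fixes Q D a n :: int
  assumes a: "1 \<le> a" and D: "1 \<le> D" and Q: "0 \<le> Q"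
    and n: "\<And>b. \<bar>b\<bar> \<le> n \<longleftrightarrow> \<bar>b\<bar> \<le> Q \<and> b\<^sup>2 \<le> 4 * a * Q"
  shows "\<bar>real (card (box_fibre Q D a)) - real (card {(b, c). \<bar>b\<bar> \<le> n \<and> \<bar>b\<^sup>2 - 4 * a * c\<bar> \<le> D})\<bar>
    \<le> 12 * sqrt D * (D / (2 * a) + 1)"
proof -
  \<comment> \<open>The exceptional \<open>b\<close>: b^2 close to 4aQ or to 0. Each window has at
    most 6 sqrt D elements.\<close>
  define X where "X = {b::int. \<bar>b\<^sup>2 - 4 * a * Q\<bar> \<le> D} \<union> {b. \<bar>b\<^sup>2 - 0\<bar> \<le> D}"
  define Y where "Y = (SIGMA b:X. {c. \<bar>b\<^sup>2 - 4 * a * c\<bar> \<le> D})"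
  let ?A = "box_fibre Q D a" and ?B = "{(b, c). \<bar>b\<bar> \<le> n \<and> \<bar>b\<^sup>2 - 4 * a * c\<bar> \<le> D}"
  have finX: "finite X" unfolding X_def using card_square_window(1)[OF D] by blast
  have "card X \<le> card {b::int. \<bar>b\<^sup>2 - 4 * a * Q\<bar> \<le> D} + card {b::int. \<bar>b\<^sup>2 - 0\<bar> \<le> D}"
    unfolding X_def by (rule card_Un_le)
  then have cardX: "real (card X) \<le> 12 * sqrt D"
    using card_square_window(2)[OF D, of "4 * a * Q"] card_square_window(2)[OF D, of 0] by linarith
  have finY: "finite Y" unfolding Y_def using finX card_discrim_window_fibre(1) a D by auto
  have "real (card Y) = (\<Sum>b\<in>X. real (card {c. \<bar>b\<^sup>2 - 4 * a * c\<bar> \<le> D}))"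
    unfolding Y_def using finX card_discrim_window_fibre(1) a D by (subst card_SigmaI) auto
  also have "\<dots> \<le> (\<Sum>b\<in>X. D / (2 * a) + 1)"
    using card_discrim_window_fibre(2) a D by (intro sum_mono) auto
  also have "\<dots> = card X * (D / (2 * a) + 1)" by simp
  also have "\<dots> \<le> 12 * sqrt D * (D / (2 * a) + 1)"
    using cardX a D by (intro mult_right_mono) auto
  finally have cardY: "real (card Y) \<le> 12 * sqrt D * (D / (2 * a) + 1)" .
  have finB: "finite ?B" using a by (intro finite_discrim_strip) simp
  have "?A \<subseteq> ?B \<union> Y"
  proof (clarify, goal_cases)
    case (1 b c)
    then have bc: "\<bar>b\<bar> \<le> Q" "\<bar>c\<bar> \<le> Q" "\<bar>b\<^sup>2 - 4 * a * c\<bar> \<le> D" and "(b, c) \<notin> Y"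
      by (auto simp: box_fibre_def)
    \<comment> \<open>If b^2 exceeds 4aQ, it does so by at most b^2 - 4ac <= D, hence
      \<open>b\<close> is exceptional.\<close>
    have "4 * a * c \<le> 4 * a * Q" using a bc by (intro mult_left_mono) auto
    then show ?case using bc \<open>(b, c) \<notin> Y\<close> n[of b] by (auto simp: Y_def X_def)
  qed
  then have "card ?A \<le> card ?B + card Y"
    using finB finY by (meson card_Un_le card_mono finite_UnI order_trans)
  moreover have "?B \<subseteq> ?A \<union> Y"
  proof (clarify, goal_cases)
    case (1 b c)
    then have bc: "\<bar>b\<bar> \<le> Q" "b\<^sup>2 \<le> 4 * a * Q" "\<bar>b\<^sup>2 - 4 * a * c\<bar> \<le> D" using n[of b] by auto
    have "\<bar>c\<bar> \<le> Q"
    proof (rule ccontr)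
      assume "\<not> \<bar>c\<bar> \<le> Q"
      \<comment> \<open>For c >= Q, 4aQ - b^2 <= 4ac - b^2 <= D. For c <= 0, b^2 <= b^2 - 4ac <=
        D.\<close>
      then consider "Q \<le> c" | "c \<le> 0" using Q by linarith
      then have "b \<in> X"
      proof cases
        case 1
        then have "4 * a * Q \<le> 4 * a * c" using a by (intro mult_left_mono) auto
        then show ?thesis using bc by (auto simp: X_def)
      next
        case 2
        then have "4 * a * c \<le> 0" using a by (intro mult_nonneg_nonpos) auto
        then show ?thesis using bc by (auto simp: X_def)
      qed
      then show False using 1 bc by (auto simp: Y_def)
    qed
    then show ?case using bc by (simp add: box_fibre_def)
  qed
  then have "card ?B \<le> card ?A + card Y"
    using finite_box_fibre finY by (meson card_Un_le card_mono finite_UnI order_trans)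
  ultimately have "\<bar>real (card ?A) - real (card ?B)\<bar> \<le> real (card Y)" by linarith
  then show ?thesis using cardY by linarith
qed

subsection \<open>Summation over the leading coefficient\<close>

definition strip_width :: "int \<Rightarrow> int \<Rightarrow> int" where
  "strip_width Q a = \<lfloor>min (real_of_int Q) (2 * sqrt (a * Q))\<rfloor>"

text \<open>Supplies the characterization of \<open>n\<close> that
  \<open>card_box_fibre_approx_strip\<close> assumes.\<close>

lemma le_strip_width_iff:
  assumes "0 \<le> a * Q"
  shows "\<bar>b\<bar> \<le> strip_width Q a \<longleftrightarrow> \<bar>b\<bar> \<le> Q \<and> b\<^sup>2 \<le> 4 * a * Q"
proof -
  have "real_of_int \<bar>b\<bar> \<le> 2 * sqrt (a * Q) \<longleftrightarrow> sqrt (real_of_int (b\<^sup>2)) \<le> sqrt (real_of_int (4 * a * Q))"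
    by (simp add: real_sqrt_mult mult.assoc)
  also have "\<dots> \<longleftrightarrow> b\<^sup>2 \<le> 4 * a * Q" by (simp only: real_sqrt_le_iff of_int_le_iff)
  finally show ?thesis by (simp only: strip_width_def le_floor_iff min.bounded_iff of_int_le_iff)
qed

lemma strip_width_bounds:
  assumes "1 \<le> a" "a \<le> Q"
  shows "a \<le> strip_width Q a" "strip_width Q a \<le> Q"
proof -
  have "a * a \<le> 4 * a * Q" using assms by (simp add: mult.assoc)
  then have "\<bar>a\<bar> \<le> strip_width Q a" using assms by (subst le_strip_width_iff) (auto simp: power2_eq_square)
  then show "a \<le> strip_width Q a" by simp
  show "strip_width Q a \<le> Q" unfolding strip_width_def by linarith
qed

text \<open>Absorbs constants inside logarithms into a factor 3, since ln 4 < 2.\<close>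

lemma ln_scaled_le:
  assumes "1 \<le> Q" "0 < c" "c \<le> 4"
  shows "1 + ln (c * Q) \<le> 3 * (1 + ln (Q::real))"
proof -
  have "ln (c * Q) = ln c + ln Q" using assms by (intro ln_mult_pos) auto
  moreover have "ln c \<le> ln 4" using assms by simp
  moreover have "ln 4 = 2 * ln (2::real)" using ln_realpow[of 2 2] by simp
  moreover have "ln (2::real) < 1" by (rule ln_2_less_1)
  moreover have "0 \<le> ln Q" using assms by simp
  ultimately show ?thesis by argo
qed

text \<open>Three errors add up: exchanging the height condition, rounding the main term, and the
  nonzero frequencies.\<close>

lemma card_box_fibre_approx:
  fixes Q D a :: int and l :: real
  assumes a: "1 \<le> a" "a \<le> Q" and D: "1 \<le> D"
  defines "l \<equiv> 1 + ln (real_of_int Q)"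
  shows "\<bar>real (card (box_fibre Q D a)) - D * (min (real_of_int Q) (2 * sqrt (a * Q)) / a)\<bar>
    \<le> 12 * sqrt D * (D / (2 * a) + 1) + (D + Q) * (1 / a)
      + (6 * Q * (\<Sum>h=1..4*a-1. sqrt (gcd h (2 * a) / (2 * a)) / h) + 18 * sqrt (Q * l) * l)"
proof -
  define n where "n = strip_width Q a"
  define N where "N = real_of_int (2 * n + 1)"
  define B where "B = min (real_of_int Q) (2 * sqrt (a * Q))"
  define K where "K = real (card {(b, c). \<bar>b\<bar> \<le> n \<and> \<bar>b\<^sup>2 - 4 * a * c\<bar> \<le> D})"
  define G where "G = (\<Sum>h=1..4*a-1. sqrt (gcd h (2 * a) / (2 * a)) / h)"
  have Q: "1 \<le> Q" using a by simp
  have n: "a \<le> n" "n \<le> Q" unfolding n_def using strip_width_bounds a by auto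
  have l: "1 \<le> l" using Q by (simp add: l_def)
  have box: "\<bar>real (card (box_fibre Q D a)) - K\<bar> \<le> 12 * sqrt D * (D / (2 * a) + 1)"
    unfolding K_def n_def using a D by (intro card_box_fibre_approx_strip le_strip_width_iff) auto
  have "\<bar>K - N * (2 * D + 1) / (4 * a)\<bar>
      \<le> (\<Sum>h=1..4*a-1. 2 * (N * sqrt (gcd h (2 * a) / (2 * a)) + sqrt (N * (1 + ln N))) / h)"
    unfolding K_def N_def using a n D by (intro card_discrim_strip_approx) auto
  also have "\<dots> \<le> (\<Sum>h=1..4*a-1. 6 * Q * (sqrt (gcd h (2 * a) / (2 * a)) / h) + 6 * sqrt (Q * l) * (1 / h))"
  proof (rule sum_mono)
    fix h assume "h \<in> {1..4*a-1}"
    then have h: "1 \<le> h" by simp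
    define s where "s = sqrt (gcd h (2 * a) / (2 * a))"
    have s: "0 \<le> s" using a by (simp add: s_def)
    have N: "1 \<le> N" "N \<le> 3 * Q" using n a by (auto simp: N_def)
    have "ln N \<le> ln (3 * real_of_int Q)" using N by simp
    then have "1 + ln N \<le> 3 * l" unfolding l_def using ln_scaled_le[of "real_of_int Q" 3] Q by simp
    then have "N * (1 + ln N) \<le> (3 * Q) * (3 * l)" using N Q by (intro mult_mono) auto
    then have "sqrt (N * (1 + ln N)) \<le> sqrt (3\<^sup>2 * (Q * l))" by (intro real_sqrt_le_mono) simp
    also have "\<dots> = 3 * sqrt (Q * l)" by (simp add: real_sqrt_mult)
    finally have r: "sqrt (N * (1 + ln N)) \<le> 3 * sqrt (Q * l)" .
    have "N * s \<le> 3 * Q * s" using N s by (intro mult_right_mono) auto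
    then have "2 * (N * s + sqrt (N * (1 + ln N))) \<le> 6 * Q * s + 6 * sqrt (Q * l)" using r by simp
    then have "2 * (N * s + sqrt (N * (1 + ln N))) / h \<le> (6 * Q * s + 6 * sqrt (Q * l)) / h"
      using h by (intro divide_right_mono) auto
    then show "2 * (N * s + sqrt (N * (1 + ln N))) / h \<le> 6 * Q * (s / h) + 6 * sqrt (Q * l) * (1 / h)"
      by (simp add: add_divide_distrib)
  qed
  also have "\<dots> = 6 * Q * G + 6 * sqrt (Q * l) * (\<Sum>h=1..4*a-1. 1 / real_of_int h)"
    unfolding G_def by (simp only: sum.distrib sum_distrib_left)
  also have "\<dots> \<le> 6 * Q * G + 6 * sqrt (Q * l) * (3 * l)"
  proof -
    have "(\<Sum>h=1..4*a-1. 1 / real_of_int h) \<le> 1 + ln (real_of_int (4 * a - 1))"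
      using a by (intro sum_inverse_le_ln) auto
    also have "\<dots> \<le> 1 + ln (4 * real_of_int Q)" using a by simp
    also have "\<dots> \<le> 3 * l" unfolding l_def using Q by (intro ln_scaled_le) auto
    finally show ?thesis using Q l by (intro add_left_mono mult_left_mono) auto
  qed
  finally have strip: "\<bar>K - N * (2 * D + 1) / (4 * a)\<bar> \<le> 6 * Q * G + 18 * sqrt (Q * l) * l" by simp
  have "\<bar>N * (2 * D + 1) / (4 * a) - D * (B / a)\<bar> \<le> (D + Q) * (1 / a)"
  proof -
    have nB: "n \<le> B" "B \<le> n + 1" unfolding n_def strip_width_def B_def by linarith+
    have B: "0 \<le> B" "B \<le> Q" using a by (auto simp: B_def)
    have "\<bar>(N - 2 * B) * (2 * D + 1)\<bar> \<le> 1 * (2 * real_of_int D + 1)"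
      \<comment> \<open>As \<open>n\<close> is the floor of \<open>B\<close>, N = 2n + 1 differs
        from 2B by at most 1.\<close>
      unfolding abs_mult using nB D by (intro mult_mono) (auto simp: N_def)
    moreover have "1 \<le> real_of_int D" using D by simp
    ultimately have "\<bar>(N - 2 * B) * (2 * D + 1) + 2 * B\<bar> \<le> 4 * (real_of_int D + Q)" using B by argo
    moreover have "N * (2 * D + 1) / (4 * a) - D * (B / a) = ((N - 2 * B) * (2 * D + 1) + 2 * B) / (4 * a)"
      using a by (simp add: field_simps)
    ultimately have "\<bar>N * (2 * D + 1) / (4 * a) - D * (B / a)\<bar> \<le> 4 * (real_of_int D + Q) / (4 * a)"
      using a by (simp only: abs_divide) (intro frac_le, auto)
    also have "\<dots> = (D + Q) * (1 / a)" using a by (simp add: field_simps)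
    finally show ?thesis .
  qed
  then show ?thesis using box strip unfolding B_def G_def by linarith
qed

lemma sum_card_box_fibre_approx:
  fixes Q D :: int and l :: real
  assumes Q: "1 \<le> Q" and D: "1 \<le> D"
  defines "l \<equiv> 1 + ln (real_of_int Q)"
  shows "\<bar>(\<Sum>a=1..Q. real (card (box_fibre Q D a))) - 2 * (1 + ln 2) * Q * D\<bar>
    \<le> 300 * (sqrt D ^ 3 * l + sqrt (Q * l) ^ 3)"
proof -
  \<comment> \<open>In terms of these square roots all error terms become monomials, and the final
    comparison is polynomial.\<close>
  define y q s where "y = sqrt D" and "q = sqrt Q" and "s = sqrt l"
  have l: "1 \<le> l" using Q by (simp add: l_def)
  have yqs: "1 \<le> y" "1 \<le> q" "1 \<le> s" "real_of_int D = y\<^sup>2" "real_of_int Q = q\<^sup>2" "l = s\<^sup>2"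
    using Q D l by (auto simp: y_def q_def s_def)
  have H: "(\<Sum>a=1..Q. 1 / real_of_int a) \<le> l" unfolding l_def using Q by (rule sum_inverse_le_ln)
  let ?f = "\<lambda>a::int. min (real_of_int Q) (2 * sqrt (a * Q)) / a"
  let ?G = "\<lambda>a::int. \<Sum>h=1..4*a-1. sqrt (gcd h (2 * a) / (2 * a)) / h"
  have "\<bar>(\<Sum>a=1..Q. real (card (box_fibre Q D a))) - D * (\<Sum>a=1..Q. ?f a)\<bar>
      = \<bar>\<Sum>a=1..Q. real (card (box_fibre Q D a)) - D * ?f a\<bar>"
    by (simp only: sum_subtractf sum_distrib_left)
  also have "\<dots> \<le> (\<Sum>a=1..Q. \<bar>real (card (box_fibre Q D a)) - D * ?f a\<bar>)" by (rule sum_abs)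
  also have "\<dots> \<le> (\<Sum>a=1..Q. 12 * sqrt D * (D / (2 * a) + 1) + (D + Q) * (1 / a)
      + (6 * Q * ?G a + 18 * sqrt (Q * l) * l))"
  proof (rule sum_mono)
    fix a assume "a \<in> {1..Q}"
    then show "\<bar>real (card (box_fibre Q D a)) - D * ?f a\<bar> \<le> 12 * sqrt D * (D / (2 * a) + 1)
        + (D + Q) * (1 / a) + (6 * Q * ?G a + 18 * sqrt (Q * l) * l)"
      using card_box_fibre_approx[of a Q D, folded l_def] D by simp
  qed
  also have "\<dots> = (\<Sum>a=1..Q. 12 * sqrt D) + (\<Sum>a=1..Q. 6 * sqrt D * D * (1 / a)) + (\<Sum>a=1..Q. (D + Q) * (1 / a))
      + ((\<Sum>a=1..Q. 6 * Q * ?G a) + (\<Sum>a=1..Q. 18 * sqrt (Q * l) * l))"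
    unfolding sum.distrib[symmetric] by (rule sum.cong) (simp_all add: algebra_simps)
  also have "\<dots> = 12 * sqrt D * Q + 6 * sqrt D * D * (\<Sum>a=1..Q. 1 / real_of_int a) + (D + Q) * (\<Sum>a=1..Q. 1 / real_of_int a)
      + (6 * Q * (\<Sum>a=1..Q. ?G a) + 18 * sqrt (Q * l) * l * Q)"
    unfolding sum_distrib_left[symmetric] using Q by (simp add: of_nat_nat)
  also have "\<dots> \<le> 12 * sqrt D * Q + 6 * sqrt D * D * l + (D + Q) * l
      + (6 * Q * (12 * sqrt Q * (3 * l)) + 18 * sqrt (Q * l) * l * Q)"
  proof -
    have "(\<Sum>a=1..Q. ?G a) \<le> 6 * sqrt (2 * Q) * (1 + ln (4 * Q))"
      using Q by (rule sum_sqrt_gcd_double_le)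
    also have "\<dots> \<le> 12 * sqrt Q * (3 * l)"
    proof (rule mult_mono)
      have "sqrt (2 * Q) \<le> sqrt (2\<^sup>2 * Q)" using Q by (intro real_sqrt_le_mono) simp
      also have "\<dots> = 2 * sqrt Q" by (simp add: real_sqrt_mult)
      finally show "6 * sqrt (2 * Q) \<le> 12 * sqrt Q" by simp
      show "1 + ln (4 * Q) \<le> 3 * l" unfolding l_def using ln_scaled_le[of Q 4] Q by simp
    qed (use Q in auto)
    finally show ?thesis using H Q D by (intro add_mono mult_left_mono order_refl) auto
  qed
  also have "\<dots> = 12 * (y * q\<^sup>2) + 6 * (y^3 * s\<^sup>2) + (y\<^sup>2 * s\<^sup>2 + q\<^sup>2 * s\<^sup>2) + (216 * (q^3 * s\<^sup>2) + 18 * (q^3 * s^3))"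
  proof -
    have "sqrt (Q * l) = q * s" by (simp add: real_sqrt_mult q_def s_def)
    then show ?thesis unfolding y_def[symmetric] q_def[symmetric]
      by (simp add: yqs) (simp add: algebra_simps power2_eq_square power3_eq_cube)
  qed
  finally have main: "\<bar>(\<Sum>a=1..Q. real (card (box_fibre Q D a))) - D * (\<Sum>a=1..Q. ?f a)\<bar> \<le> \<dots>" .
  have "\<bar>D * (\<Sum>a=1..Q. ?f a) - D * (2 * Q * (1 + ln 2))\<bar> \<le> D * (6 * sqrt Q)"
    using mult_left_mono[OF sum_range_approx[OF Q], of D] D
    by (simp add: abs_mult flip: right_diff_distrib)
  then have rng: "\<bar>D * (\<Sum>a=1..Q. ?f a) - D * (2 * Q * (1 + ln 2))\<bar> \<le> 6 * (y\<^sup>2 * q)"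
    by (simp add: yqs(4) q_def)
  have E: "y^3 \<le> y^3 * s\<^sup>2" "y\<^sup>2 * s\<^sup>2 \<le> y^3 * s\<^sup>2" "q^3 \<le> q^3 * s^3" "q^3 * s\<^sup>2 \<le> q^3 * s^3" "q\<^sup>2 * s\<^sup>2 \<le> q^3 * s^3"
    using yqs by (auto intro!: mult_mono power_increasing one_le_power)
  \<comment> \<open>A mixed cubic monomial is at most the cube of the larger variable.\<close>
  have mixed: "y * q\<^sup>2 \<le> y^3 + q^3" "y\<^sup>2 * q \<le> y^3 + q^3"
  proof -
    have "y * q\<^sup>2 \<le> y^3 + q^3 \<and> y\<^sup>2 * q \<le> y^3 + q^3"
    proof (cases "y \<le> q")
      case True
      have "y * q\<^sup>2 \<le> q * q\<^sup>2" "y\<^sup>2 * q \<le> q\<^sup>2 * q"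
        using True yqs by (auto intro!: mult_right_mono power_mono)
      moreover have "0 \<le> y^3" using yqs by simp
      ultimately show ?thesis by (simp add: power2_eq_square power3_eq_cube mult.assoc)
    next
      case False
      have "y * q\<^sup>2 \<le> y * y\<^sup>2" "y\<^sup>2 * q \<le> y\<^sup>2 * y"
        using False yqs by (auto intro!: mult_left_mono power_mono)
      moreover have "0 \<le> q^3" using yqs by simp
      ultimately show ?thesis by (simp add: power2_eq_square power3_eq_cube mult.assoc)
    qed
    then show "y * q\<^sup>2 \<le> y^3 + q^3" "y\<^sup>2 * q \<le> y^3 + q^3" by simp_all
  qed
  have nonneg: "0 \<le> y^3 * s\<^sup>2" "0 \<le> q^3 * s^3" using yqs by auto
  have goal_eq: "sqrt D ^ 3 * l + sqrt (Q * l) ^ 3 = y^3 * s\<^sup>2 + q^3 * s^3"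
  proof -
    have "sqrt (Q * l) = q * s" by (simp add: real_sqrt_mult q_def s_def)
    then show ?thesis
      unfolding y_def[symmetric] by (simp only: power_mult_distrib) (simp only: yqs(6))
  qed
  \<comment> \<open>The coefficients add up to 25 for y^3 s^2 and 253 for q^3 s^3.\<close>
  have "\<bar>(\<Sum>a=1..Q. real (card (box_fibre Q D a))) - D * (2 * Q * (1 + ln 2))\<bar> \<le> 300 * (y^3 * s\<^sup>2 + q^3 * s^3)"
    using main rng E mixed nonneg by argo
  then show ?thesis unfolding goal_eq by (simp add: algebra_simps)
qed

subsection \<open>Counting polynomials\<close>

lemma poly_height_le_iff:
  assumes "degree p = 2"
  shows "of_int (poly_height p) \<le> (Q::real) \<longleftrightarrow>
    \<bar>coeff p 2\<bar> \<le> \<lfloor>Q\<rfloor> \<and> \<bar>coeff p 1\<bar> \<le> \<lfloor>Q\<rfloor> \<and> \<bar>coeff p 0\<bar> \<le> \<lfloor>Q\<rfloor>"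
proof -
  have "{..2::nat} = {0, 1, 2}" by auto
  then have "poly_height p \<le> \<lfloor>Q\<rfloor> \<longleftrightarrow>
      \<bar>coeff p 2\<bar> \<le> \<lfloor>Q\<rfloor> \<and> \<bar>coeff p 1\<bar> \<le> \<lfloor>Q\<rfloor> \<and> \<bar>coeff p 0\<bar> \<le> \<lfloor>Q\<rfloor>"
    by (auto simp: poly_height_def assms)
  then show ?thesis by (simp add: le_floor_iff)
qed

lemma quadratic_discrim_le_iff:
  "\<bar>quadratic_discrim p\<bar> \<le> D \<longleftrightarrow> \<bar>(coeff p 1)\<^sup>2 - 4 * coeff p 2 * coeff p 0\<bar> \<le> \<lfloor>D\<rfloor>"
proof -
  have "quadratic_discrim p = of_int ((coeff p 1)\<^sup>2 - 4 * coeff p 2 * coeff p 0)"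
    by (simp add: quadratic_discrim_def discrim_def)
  then show ?thesis by (simp only: le_floor_iff of_int_abs)
qed

lemma degree_2_conv_pCons:
  assumes "degree p = 2"
  shows "p = [:coeff p 0, coeff p 1, coeff p 2:]"
proof (rule poly_eqI)
  fix n
  show "coeff p n = coeff [:coeff p 0, coeff p 1, coeff p 2:] n"
    using assms by (auto simp: coeff_pCons coeff_eq_0 numeral_2_eq_2 split: nat.split)
qed

text \<open>Negation preserves height and discriminant and flips the sign of the leading
  coefficient, so the set is a disjoint union of two copies of \<open>P\<close>. Coefficients and
  discriminant are integers, hence the floors.\<close>

lemma count_quadratics_eq:
  assumes "0 \<le> Q"
  shows "real (count_quadratics Q D) = 2 * (\<Sum>a=1..\<lfloor>Q\<rfloor>. real (card (box_fibre \<lfloor>Q\<rfloor> \<lfloor>D\<rfloor> a)))"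
proof -
  let ?Q = "\<lfloor>Q\<rfloor>" and ?D = "\<lfloor>D\<rfloor>"
  define P where "P = (SIGMA a:{1..?Q}. box_fibre ?Q ?D a)"
  let ?pos = "\<lambda>(a, b, c). [:c, b, a:]" and ?neg = "\<lambda>(a, b, c). [:- c, - b, - a:] :: int poly"
  have finP: "finite P" by (simp add: P_def finite_box_fibre)
  have mem: "[:c, b, a:] \<in> quadratics Q D \<longleftrightarrow> \<bar>a\<bar> \<le> ?Q \<and> (b, c) \<in> box_fibre ?Q ?D a" if "a \<noteq> 0" for a b c
  proof -
    have "degree [:c, b, a:] = 2" using that by simp
    then show ?thesis
      by (auto simp: quadratics_def poly_height_le_iff quadratic_discrim_le_iff box_fibre_def
          coeff_pCons numeral_2_eq_2)
  qed
  have neg: "(- b, - c) \<in> box_fibre ?Q ?D (- a) \<longleftrightarrow> (b, c) \<in> box_fibre ?Q ?D a" for a b c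
    by (simp add: box_fibre_def)
  have "quadratics Q D = ?pos ` P \<union> ?neg ` P"
  proof (intro equalityI subsetI)
    fix p assume p: "p \<in> quadratics Q D"
    define a b c where "a = coeff p 2" and "b = coeff p 1" and "c = coeff p 0"
    have deg: "degree p = 2" using p by (simp add: quadratics_def)
    have eq: "p = [:c, b, a:]" unfolding a_def b_def c_def using deg by (rule degree_2_conv_pCons)
    have a: "a \<noteq> 0" using deg leading_coeff_0_iff[of p] by (auto simp: a_def)
    have bc: "\<bar>a\<bar> \<le> ?Q" "(b, c) \<in> box_fibre ?Q ?D a" using p mem[OF a] by (auto simp: eq)
    show "p \<in> ?pos ` P \<union> ?neg ` P"
    proof (cases "0 < a")
      case True
      then have "(a, b, c) \<in> P" using bc by (simp add: P_def)
      then show ?thesis by (force simp: eq)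
    next
      case False
      then have "(- a, - b, - c) \<in> P" using bc a neg[of b c a] by (simp add: P_def)
      then have "?neg (- a, - b, - c) \<in> ?neg ` P" by (rule imageI)
      then show ?thesis by (simp add: eq)
    qed
  next
    fix p assume "p \<in> ?pos ` P \<union> ?neg ` P"
    then obtain a b c where abc: "(a, b, c) \<in> P" and p: "p = [:c, b, a:] \<or> p = [:- c, - b, - a:]" by auto
    have "1 \<le> a" "a \<le> ?Q" "(b, c) \<in> box_fibre ?Q ?D a" using abc by (auto simp: P_def)
    then show "p \<in> quadratics Q D" using p mem[of a c b] mem[of "- a" "- c" "- b"] neg[of b c a] by auto
  qed
  moreover have "?pos ` P \<inter> ?neg ` P = {}" by (auto simp: P_def)
  moreover have "inj_on ?pos P" "inj_on ?neg P" by (auto simp: inj_on_def)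
  ultimately have "card (quadratics Q D) = card P + card P"
    using finP by (simp add: card_Un_disjoint card_image)
  moreover have "card P = (\<Sum>a=1..?Q. card (box_fibre ?Q ?D a))"
    unfolding P_def by (simp add: finite_box_fibre)
  ultimately show ?thesis by (simp add: count_quadratics_def)
qed

lemma powr_three_halves:
  assumes "0 \<le> x"
  shows "x powr (3/2) = sqrt x ^ 3"
proof (cases "x = 0")
  case False
  then have "sqrt x ^ 3 = (x powr (1/2)) powr 3" using assms by (simp add: powr_half_sqrt powr_realpow)
  then show ?thesis by (simp add: powr_powr)
qed simp

theorem theorem1:
  shows "\<exists>C::real. \<forall>Q D::real. 0 < Q \<longrightarrow> 1 \<le> D \<longrightarrow> D \<le> Q\<^sup>2 / 2 \<longrightarrow>
    \<bar>real (count_quadratics Q D) - kappa * Q * D\<bar>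
      \<le> C * (D powr (3/2) * ln Q + (Q * ln Q) powr (3/2))"
proof (intro exI[of _ 5000] allI impI)
  fix Q D :: real
  assume Q0: "0 < Q" and D: "1 \<le> D" and DQ: "D \<le> Q\<^sup>2 / 2"
  define q d l where "q = \<lfloor>Q\<rfloor>" and "d = \<lfloor>D\<rfloor>" and "l = ln Q"
  \<comment> \<open>Q^2 >= 2 keeps ln Q away from 0, so constants can be absorbed into multiples of
    ln Q.\<close>
  have "2 * 1 \<le> Q\<^sup>2" using D DQ by simp
  then have "ln 2 \<le> ln (Q\<^sup>2)" using Q0 by (subst ln_le_cancel_iff) auto
  then have l: "1 / 3 \<le> l" using ln2_ge_two_thirds Q0 by (simp add: l_def ln_realpow)
  have Q: "1 \<le> Q" using l Q0 ln_less_zero_iff[of Q] unfolding l_def by linarith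
  have q: "1 \<le> q" "q \<le> Q" "Q \<le> q + 1" and d: "1 \<le> d" "d \<le> D" "D \<le> d + 1"
    using Q D by (auto simp: q_def d_def le_floor_iff)
  define S where "S = sqrt D ^ 3 * l"
  define T where "T = sqrt (Q * l) ^ 3"
  have lq: "0 \<le> 1 + ln (real_of_int q)" "1 + ln (real_of_int q) \<le> 4 * l"
  proof -
    have "ln (real_of_int q) \<le> l" unfolding l_def using q Q by simp
    then show "1 + ln (real_of_int q) \<le> 4 * l" using l by simp
  qed (use q in simp)
  \<comment> \<open>Both signs of the leading coefficient double 300 to 600 and 2 (1 + ln 2) to
    \<open>kappa\<close>.\<close>
  have count: "\<bar>real (count_quadratics Q D) - kappa * q * d\<bar>
      \<le> 600 * (sqrt d ^ 3 * (1 + ln q) + sqrt (q * (1 + ln q)) ^ 3)"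
    using sum_card_box_fibre_approx[OF q(1) d(1)] count_quadratics_eq[of Q D] Q
    unfolding q_def[symmetric] d_def[symmetric] kappa_def by (simp add: algebra_simps)
  have S_le: "sqrt d ^ 3 * (1 + ln q) \<le> 4 * S"
  proof -
    have "sqrt d ^ 3 * (1 + ln q) \<le> sqrt D ^ 3 * (4 * l)"
      using d lq by (intro mult_mono power_mono) auto
    then show ?thesis by (simp add: S_def)
  qed
  have T_le: "sqrt (q * (1 + ln q)) ^ 3 \<le> 8 * T"
  proof -
    have "q * (1 + ln q) \<le> Q * (4 * l)" using q lq by (intro mult_mono) auto
    then have "sqrt (q * (1 + ln q)) \<le> sqrt (2\<^sup>2 * (Q * l))" by (intro real_sqrt_le_mono) simp
    also have "\<dots> = 2 * sqrt (Q * l)" by (simp add: real_sqrt_mult)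
    finally have "sqrt (q * (1 + ln q)) ^ 3 \<le> (2 * sqrt (Q * l)) ^ 3"
      using q lq by (intro power_mono) auto
    then show ?thesis by (simp add: T_def power_mult_distrib)
  qed
  \<comment> \<open>This and the next bound absorb the O(Q + D) cost of replacing the floors by
    \<open>Q\<close> and \<open>D\<close>.\<close>
  have D_le: "D \<le> 3 * S"
  proof -
    have "D * 1 \<le> sqrt D ^ 3 * (3 * l)"
    proof (rule mult_mono)
      have "sqrt D ^ 2 \<le> sqrt D ^ 3" using D by (intro power_increasing) auto
      then show "D \<le> sqrt D ^ 3" using D by simp
    qed (use l D in auto)
    then show ?thesis by (simp add: S_def)
  qed
  have Q_le: "Q \<le> 8 * T"
  proof -
    have "sqrt Q * 1 \<le> sqrt (Q * (4 * l))" using Q l by (simp add: mult_le_cancel_left)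
    then have "sqrt Q ^ 3 \<le> sqrt (Q * (4 * l)) ^ 3" using Q by (intro power_mono) auto
    moreover have "sqrt (Q * (4 * l)) = 2 * sqrt (Q * l)" by (simp add: real_sqrt_mult)
    moreover have "sqrt Q ^ 2 \<le> sqrt Q ^ 3" using Q by (intro power_increasing) auto
    ultimately show ?thesis using Q by (simp add: T_def power_mult_distrib)
  qed
  have count': "\<bar>real (count_quadratics Q D) - kappa * q * d\<bar> \<le> 600 * (4 * S + 8 * T)"
    using S_le T_le by (intro order_trans[OF count] mult_left_mono add_mono) auto
  have k: "0 \<le> kappa" "kappa \<le> 8" using ln_2_less_1 by (auto simp: kappa_def)
  have "\<bar>kappa * q * d - kappa * Q * D\<bar> \<le> 8 * (Q + D)"
  proof -
    have "kappa * Q * D - kappa * q * d = kappa * (Q * (D - d) + (Q - q) * d)" by (simp add: algebra_simps)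
    moreover have "0 \<le> Q * (D - d)" "0 \<le> (Q - q) * d" using q d Q by auto
    moreover have "Q * (D - d) \<le> Q * 1" using d Q by (intro mult_left_mono) auto
    moreover have "(Q - q) * d \<le> 1 * D" using q d by (intro mult_mono) auto
    ultimately have "0 \<le> kappa * Q * D - kappa * q * d" "kappa * Q * D - kappa * q * d \<le> 8 * (Q + D)"
      using k mult_mono[of kappa 8 "Q * (D - d) + (Q - q) * d" "Q + D"] by simp_all
    then show ?thesis by linarith
  qed
  then have "\<bar>real (count_quadratics Q D) - kappa * Q * D\<bar> \<le> 600 * (4 * S + 8 * T) + 8 * (Q + D)"
    using count' by argo
  \<comment> \<open>The coefficients are 2400 + 24 for \<open>S\<close> and 4800 + 64 for
    \<open>T\<close>.\<close>
  also have "\<dots> \<le> 5000 * (S + T)" using D_le Q_le D Q by simp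
  finally have "\<bar>real (count_quadratics Q D) - kappa * Q * D\<bar> \<le> 5000 * (S + T)" .
  then show "\<bar>real (count_quadratics Q D) - kappa * Q * D\<bar>
      \<le> 5000 * (D powr (3/2) * ln Q + (Q * ln Q) powr (3/2))"
    using D Q l by (simp add: powr_three_halves S_def T_def l_def)
qed

end
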